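(* Suppose that for every $(s,a)\in\mathcal S\times\mathcal A$ the ambiguity set $\mathcal P_{s,a}$ is relatively strongly convex with respect to $R_{s,a}>0$, let $R=\max_{s\in\mathcal S,a\in\mathcal A}R_{s,a}$, and suppose $\dim(\mathcal P_{s,a})=|\mathcal S|-1$. Let $r_*=\min_{\pi\in\Pi}\|\mathrm{Proj}_{\mathcal H}(V^\pi_r)\|_2$, where $\mathcal H=\{x\in\mathbb R^{|\mathcal S|}:\mathbf 1^\top x=0\}$, and suppose $r_*>0$. Let $\rho$ be a probability distribution on $\mathcal S$, $\pi^*$ an optimal robust policy, and $M=\sup_{u\in\mathcal U}\|d_\rho^{\pi^*,u}/\rho\|_\infty<\infty$. For any $\eta>0$, let $\eta_k=\eta$ for all $k\ge0$. If (1) the distance-generating function $w$ is $\mu$-strongly convex with respect to the $\|\cdot\|_1$-norm; (2) $D_w^*=\sup_{\pi\in\Pi}\max_{s\in\mathcal S}D^{\pi^*}_{\pi}(s)<\infty$, then for every $k\ge1$ the robust policy mirror descent (RPMD) method outputs a policy $\pi_k$ satisfying $$f_\rho(\pi_k)-f_\rho(\pi^* )\le\frac{M}{(1-\gamma)k}\big(f_\rho(\pi_0)-f_\rho(\pi^* )\big)+\frac{D_w}{(1-\gamma)\eta k}+\frac{2\gamma|\mathcal S|^2RD_w^*}{(1-\gamma)^{7/2}r_*\sqrt{\eta\mu k}} .$$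
   Context: Robust MDP. $\mathcal S,\mathcal A$ are finite nonempty state and action sets, $c:\mathcal S\times\mathcal A\to\mathbb R$ is a cost with $0<c(s,a)\le1$, $\gamma\in(0,1)$ is the discount factor, and $\mathbb P_{N}$ is a nominal transition kernel ($\mathbb P_N(\cdot|s,a)\in\Delta_{\mathcal S}$, where $\Delta_{\mathcal X}$ is the probability simplex over $\mathcal X$). The uncertainty set $\mathcal U\subset\mathbb R^{|\mathcal S|\times|\mathcal S|\times|\mathcal A|}$ is nonempty, compact and $(s,a)$-rectangular: $\mathcal U=\prod_{s,a}\mathcal U_{s,a}$ with $\mathcal U_{s,a}=\{u(\cdot|s,a):u\in\mathcal U\}$; for every $u\in\mathcal U$, $\mathbb P_u(\cdot|s,a)=\mathbb P_N(\cdot|s,a)+u(\cdot|s,a)$ is a transition kernel. The ambiguity set is $\mathcal P_{s,a}=\mathbb P_N(\cdot|s,a)+\mathcal U_{s,a}\subset\Delta_{\mathcal S}$. $\Pi$ is the set of stationary randomized policies ($\pi(\cdot|s)\in\Delta_{\mathcal A}$ for all $s$). Relative strong convexity. A set $\mathcal C\subset\mathbb R^d$ is relatively strongly convex with respect to $R>0$ if it is bounded and for all $x,y\in\mathcal C$, $\lambda\in[0,1]$, one has $\mathcal B(\lambda x+(1-\lambda)y,\delta)\cap\mathrm{Aff}(\mathcal C)\subset\mathcal C$ with $\delta=\frac{\lambda(1-\lambda)}{2R}\|x-y\|_2^2$, where $\mathcal B(z,r)$ is the closed Euclidean ball and $\mathrm{Aff}$ the affine hull; $\dim(\mathcal C)$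 is the dimension of $\mathrm{Aff}(\mathcal C)$. $\mathrm{Proj}_{\mathcal H}$ is Euclidean orthogonal projection. Values. $V^\pi_u(s)=\mathbb E[\sum_{t\ge0}\gamma^t c(s_t,a_t)\mid s_0=s]$ with $a_t\sim\pi(\cdot|s_t)$, $s_{t+1}\sim\mathbb P_u(\cdot|s_t,a_t)$; $Q^\pi_u(s,a)$ is the same with in addition $a_0=a$. Robust values: $V^\pi_r(s)=\max_{u\in\mathcal U}V^\pi_u(s)$, $Q^\pi_r(s,a)=\max_{u\in\mathcal U}Q^\pi_u(s,a)$. Objective: $f_\rho(\pi)=\mathbb E_{s\sim\rho}[V^\pi_r(s)]$. An optimal robust policy $\pi^*$ satisfies $V^{\pi^*}_r(s)\le V^\pi_r(s)$ for all $s\in\mathcal S$, $\pi\in\Pi$. Visitation measures: $d^{\pi,u}_s(s')=(1-\gamma)\sum_{t\ge0}\gamma^t\Pr(s_t=s'\mid s_0=s)$ under policy $\pi$ and kernel $\mathbb P_u$; $d^{\pi,u}_\rho(s')=\mathbb E_{s\sim\rho}d^{\pi,u}_s(s')$. Ratios of measures are entrywise. RPMD. Let $w:\mathbb R^{|\mathcal A|}\to\mathbb R$ be strictly convex and $D^{\pi}_{\pi'}(s)=w(\pi(\cdot|s))-w(\pi'(\cdot|s))-\langle\partial w(\pi'(\cdot|s)),\pi(\cdot|s)-\pi'(\cdot|s)\rangle$, where $\partial w(p)$ denotes a subgradient of $w$ at $p$ (when $w$ is not differentiable, the subgradient used at an iterate $\pi_{k+1}(\cdot|s)$ is one for which the first-order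 optimality condition of the update below holds). Given $\pi_0\in\Pi$ and stepsizes $\eta_k>0$, RPMD sets, for every $s\in\mathcal S$, $\pi_{k+1}(\cdot|s)=\operatorname{argmin}_{p(\cdot|s)\in\Delta_{\mathcal A}}\eta_k\langle Q^{\pi_k}_r(s,\cdot),p(\cdot|s)\rangle+D^{p}_{\pi_k}(s)$. $D_w=\max_{\pi\in\Pi}\max_{s\in\mathcal S}D^\pi_{\pi_0}(s)$. "$w$ is $\mu$-strongly convex w.r.t. $\|\cdot\|_1$" ($\mu>0$) means $D^{\pi}_{\pi'}(s)\ge\frac\mu2\|\pi(\cdot|s)-\pi'(\cdot|s)\|_1^2$. *)

theory Defs
  imports "HOL-Probability.Probability"
begin

definition prob_simplex :: "(real^'n) set" where
  "prob_simplex = {p. (\<forall>i. 0 \<le> p $ i) \<and> (\<Sum>i\<in>UNIV. p $ i) = 1}"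

definition rel_strongly_convex :: "real \<Rightarrow> 'b::euclidean_space set \<Rightarrow> bool" where
  "rel_strongly_convex R C \<longleftrightarrow> bounded C \<and>
    (\<forall>x\<in>C. \<forall>y\<in>C. \<forall>t\<in>{0..1}.
      cball (t *\<^sub>R x + (1 - t) *\<^sub>R y) (t * (1 - t) / (2 * R) * (norm (x - y))\<^sup>2) \<inter> affine hull C \<subseteq> C)"

definition strictly_convex :: "('b::real_vector \<Rightarrow> real) \<Rightarrow> bool" where
  "strictly_convex f \<longleftrightarrow> (\<forall>x y t. x \<noteq> y \<longrightarrow> 0 < t \<longrightarrow> t < 1 \<longrightarrow>
     f ((1 - t) *\<^sub>R x + t *\<^sub>R y) < (1 - t) * f x + t * f y)"

definition subdifferential :: "('b::real_inner \<Rightarrow> real) \<Rightarrow> 'b \<Rightarrow> 'b set" where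
  "subdifferential f p = {g. \<forall>y. f y \<ge> f p + g \<bullet> (y - p)}"

text \<open>The map \<open>g\<close> selects the subgradient written $\partial w(q)$.\<close>

definition bregman :: "('b::real_inner \<Rightarrow> real) \<Rightarrow> ('b \<Rightarrow> 'b) \<Rightarrow> 'b \<Rightarrow> 'b \<Rightarrow> real" where
  "bregman w g p q = w p - w q - g q \<bullet> (p - q)"

definition norm1 :: "real^'n \<Rightarrow> real" where
  "norm1 x = (\<Sum>i\<in>UNIV. \<bar>x $ i\<bar>)"

definition zero_sum_space :: "(real^'n) set" where
  "zero_sum_space = {x. (\<Sum>i\<in>UNIV. x $ i) = 0}"


text \<open>
  Policies are \<open>\<pi> $ s $ a\<close> for $\pi(a|s)$ and kernels are \<open>P $ s $ a $ s'\<close> for $P(s'|s,a)$, so that the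
  kernel of \<open>u\<close> is the vector sum \<open>PN + u\<close>.
\<close>

definition policies :: "(real^'a^'s) set" where
  "policies = {\<pi>. \<forall>s. \<pi> $ s \<in> prob_simplex}"

definition kernels :: "(real^'s^'a^'s) set" where
  "kernels = {P. \<forall>s a. P $ s $ a \<in> prob_simplex}"

text \<open>
  Law of $(s_n,a_n)$ given the history \<open>\<omega>\<close> of state-action pairs before time \<open>n\<close>; \<open>init\<close> is the law
  of $(s_0,a_0)$.
\<close>

definition step_law ::
  "real^'a^'s \<Rightarrow> real^'s^'a^'s \<Rightarrow> ('s \<times> 'a \<Rightarrow> real) \<Rightarrow> nat \<Rightarrow> (nat \<Rightarrow> 's \<times> 'a) \<Rightarrow> ('s \<times> 'a) measure" where
  "step_law \<pi> P init n \<omega> = point_measure UNIV (\<lambda>(s', a'). ennreal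
     (case n of 0 \<Rightarrow> init (s', a')
      | Suc m \<Rightarrow> P $ fst (\<omega> m) $ snd (\<omega> m) $ s' * \<pi> $ s' $ a'))"

definition trajectory ::
  "real^'a^'s \<Rightarrow> real^'s^'a^'s \<Rightarrow> ('s \<times> 'a \<Rightarrow> real) \<Rightarrow> (nat \<Rightarrow> 's \<times> 'a) measure" where
  "trajectory \<pi> P init =
     projective_family.lim UNIV (Ionescu_Tulcea.CI (step_law \<pi> P init) (\<lambda>_. count_space UNIV))
       (\<lambda>_. count_space UNIV)"

definition start_state :: "real^'a^'s \<Rightarrow> 's \<Rightarrow> 's \<times> 'a \<Rightarrow> real" where
  "start_state \<pi> s = (\<lambda>(s', a'). if s' = s then \<pi> $ s' $ a' else 0)"

definition start_pair :: "'s \<Rightarrow> 'a \<Rightarrow> 's \<times> 'a \<Rightarrow> real" where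
  "start_pair s a = (\<lambda>x. if x = (s, a) then 1 else 0)"

text \<open>The trajectory measure is a genuine instance of the Ionescu-Tulcea construction.\<close>

lemma Ionescu_Tulcea_step_law:
  fixes \<pi> :: "real^'a^'s" and P :: "real^'s^'a^'s"
  assumes "\<pi> \<in> policies" "P \<in> kernels"
    and "\<And>x. 0 \<le> init x" "(\<Sum>x\<in>UNIV. init x) = 1"
  shows "Ionescu_Tulcea (step_law \<pi> P init) (\<lambda>_. count_space UNIV)"
proof -
  have nonneg: "0 \<le> (case n of 0 \<Rightarrow> init (s', a')
      | Suc m \<Rightarrow> P $ fst (\<omega> m) $ snd (\<omega> m) $ s' * \<pi> $ s' $ a')" for n \<omega> s' a'
    using assms by (auto simp: policies_def kernels_def prob_simplex_def split: nat.split)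
  have "(\<Sum>(s', a')\<in>UNIV. P $ s $ a $ s' * \<pi> $ s' $ a') = 1" for s a
  proof -
    have "(\<Sum>(s', a')\<in>UNIV. P $ s $ a $ s' * \<pi> $ s' $ a')
        = (\<Sum>s'\<in>UNIV. P $ s $ a $ s' * (\<Sum>a'\<in>UNIV. \<pi> $ s' $ a'))"
      by (simp add: sum.cartesian_product sum_distrib_left)
    then show ?thesis
      using assms by (simp add: policies_def kernels_def prob_simplex_def)
  qed
  then have total: "(\<Sum>(s', a')\<in>UNIV. case n of 0 \<Rightarrow> init (s', a')
      | Suc m \<Rightarrow> P $ fst (\<omega> m) $ snd (\<omega> m) $ s' * \<pi> $ s' $ a') = 1" for n \<omega>
    using assms(4) by (cases n) (auto simp: case_prod_beta)
  have prob: "prob_space (step_law \<pi> P init n \<omega>)" for n \<omega>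
    unfolding step_law_def
    by (rule prob_space_point_measure)
       (use total[where n = n and \<omega> = \<omega>] nonneg[where n = n and \<omega> = \<omega>] in \<open>auto simp: case_prod_beta sum_ennreal\<close>)
  have space_PiM_UNIV: "PiM {0..<n} (\<lambda>_. count_space UNIV)
      = count_space (PiE {0..<n} (\<lambda>_. UNIV :: ('s \<times> 'a) set))" for n :: nat
    by (rule count_space_PiM_finite) auto
  show ?thesis
  proof (rule Ionescu_Tulcea.intro)
    fix n
    show "step_law \<pi> P init n \<in> measurable (PiM {0..<n} (\<lambda>_. count_space UNIV))
        (subprob_algebra (count_space UNIV))"
      unfolding space_PiM_UNIV
      by (auto simp: space_subprob_algebra step_law_def sets_point_measure
          intro!: prob_space_imp_subprob_space prob[unfolded step_law_def])
  qed (rule prob)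
qed

definition state_value :: "('s \<Rightarrow> 'a \<Rightarrow> real) \<Rightarrow> real \<Rightarrow> real^'s^'a^'s \<Rightarrow> real^'a^'s \<Rightarrow> 's \<Rightarrow> real" where
  "state_value c \<gamma> P \<pi> s =
     (\<integral>\<omega>. (\<Sum>t. \<gamma> ^ t * c (fst (\<omega> t)) (snd (\<omega> t))) \<partial>trajectory \<pi> P (start_state \<pi> s))"

definition action_value :: "('s \<Rightarrow> 'a \<Rightarrow> real) \<Rightarrow> real \<Rightarrow> real^'s^'a^'s \<Rightarrow> real^'a^'s \<Rightarrow> 's \<Rightarrow> 'a \<Rightarrow> real" where
  "action_value c \<gamma> P \<pi> s a =
     (\<integral>\<omega>. (\<Sum>t. \<gamma> ^ t * c (fst (\<omega> t)) (snd (\<omega> t))) \<partial>trajectory \<pi> P (start_pair s a))"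

definition visitation :: "real \<Rightarrow> real^'s^'a^'s \<Rightarrow> real^'a^'s \<Rightarrow> 's \<Rightarrow> 's \<Rightarrow> real" where
  "visitation \<gamma> P \<pi> s s' =
     (1 - \<gamma>) * (\<Sum>t. \<gamma> ^ t *
       measure (trajectory \<pi> P (start_state \<pi> s)) {\<omega>. fst (\<omega> t) = s'})"

definition visitation_from :: "real \<Rightarrow> real^'s^'a^'s \<Rightarrow> real^'a^'s \<Rightarrow> real^'s \<Rightarrow> 's \<Rightarrow> real" where
  "visitation_from \<gamma> P \<pi> \<rho> s' = (\<Sum>s\<in>UNIV. \<rho> $ s * visitation \<gamma> P \<pi> s s')"


definition u_section :: "(real^'s^'a^'s) set \<Rightarrow> 's \<Rightarrow> 'a \<Rightarrow> (real^'s) set" where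
  "u_section U s a = (\<lambda>u. u $ s $ a) ` U"

definition ambiguity_set :: "real^'s^'a^'s \<Rightarrow> (real^'s^'a^'s) set \<Rightarrow> 's \<Rightarrow> 'a \<Rightarrow> (real^'s) set" where
  "ambiguity_set PN U s a = (\<lambda>v. PN $ s $ a + v) ` u_section U s a"

locale robust_mdp =
  fixes c :: "'s::finite \<Rightarrow> 'a::finite \<Rightarrow> real"
    and \<gamma> :: real
    and PN :: "real^'s^'a^'s"
    and U :: "(real^'s^'a^'s) set"
  assumes cost_pos: "0 < c s a"
    and cost_le_1: "c s a \<le> 1"
    and discount: "0 < \<gamma>" "\<gamma> < 1"
    and nominal: "PN \<in> kernels"
    and nonempty: "U \<noteq> {}"
    and compact: "compact U"
    and rectangular: "U = {u. \<forall>s a. u $ s $ a \<in> u_section U s a}"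
    and perturbed: "u \<in> U \<Longrightarrow> PN + u \<in> kernels"

text \<open>
  The suprema over \<open>U\<close> below are attained, because \<open>U\<close> is compact and values depend continuously
  on the kernel.
\<close>

definition robust_V ::
  "('s \<Rightarrow> 'a \<Rightarrow> real) \<Rightarrow> real \<Rightarrow> real^'s^'a^'s \<Rightarrow> (real^'s^'a^'s) set \<Rightarrow> real^'a^'s \<Rightarrow> real^'s" where
  "robust_V c \<gamma> PN U \<pi> = (\<chi> s. SUP u\<in>U. state_value c \<gamma> (PN + u) \<pi> s)"

definition robust_Q ::
  "('s \<Rightarrow> 'a \<Rightarrow> real) \<Rightarrow> real \<Rightarrow> real^'s^'a^'s \<Rightarrow> (real^'s^'a^'s) set \<Rightarrow> real^'a^'s \<Rightarrow> real^'a^'s" where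
  "robust_Q c \<gamma> PN U \<pi> = (\<chi> s a. SUP u\<in>U. action_value c \<gamma> (PN + u) \<pi> s a)"

definition objective ::
  "('s \<Rightarrow> 'a \<Rightarrow> real) \<Rightarrow> real \<Rightarrow> real^'s^'a^'s \<Rightarrow> (real^'s^'a^'s) set \<Rightarrow> real^'s \<Rightarrow> real^'a^'s \<Rightarrow> real" where
  "objective c \<gamma> PN U \<rho> \<pi> = (\<Sum>s\<in>UNIV. \<rho> $ s * robust_V c \<gamma> PN U \<pi> $ s)"

definition optimal_policy ::
  "('s \<Rightarrow> 'a \<Rightarrow> real) \<Rightarrow> real \<Rightarrow> real^'s^'a^'s \<Rightarrow> (real^'s^'a^'s) set \<Rightarrow> real^'a^'s \<Rightarrow> bool" where
  "optimal_policy c \<gamma> PN U \<pi>' \<longleftrightarrow> \<pi>' \<in> policies \<and>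
     (\<forall>\<pi>\<in>policies. \<forall>s. robust_V c \<gamma> PN U \<pi>' $ s \<le> robust_V c \<gamma> PN U \<pi> $ s)"

text \<open>
  $\min_{\pi}\|\mathrm{Proj}_{\mathcal H}(V^\pi_r)\|_2$; the minimum is attained, because the policy set is
  compact and the robust value is continuous in the policy.
\<close>

definition r_min ::
  "('s \<Rightarrow> 'a \<Rightarrow> real) \<Rightarrow> real \<Rightarrow> real^'s^'a^'s \<Rightarrow> (real^'s^'a^'s) set \<Rightarrow> real" where
  "r_min c \<gamma> PN U = (INF \<pi>\<in>policies. norm (closest_point zero_sum_space (robust_V c \<gamma> PN U \<pi>)))"

text \<open>
  $\sup_{u}\|d^{\pi,u}_\rho/\rho\|_\infty$. The quotient is taken in \<^typ>\<open>ennreal\<close>, where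
  \<open>x / 0 = \<infinity>\<close> for \<open>x > 0\<close> and \<open>0 / 0 = 0\<close>, so that a visited state outside the support of \<open>\<rho>\<close>
  makes it infinite.
\<close>

definition mismatch ::
  "real \<Rightarrow> real^'s^'a^'s \<Rightarrow> (real^'s^'a^'s) set \<Rightarrow> real^'a^'s \<Rightarrow> real^'s \<Rightarrow> ennreal" where
  "mismatch \<gamma> PN U \<pi> \<rho> =
     (SUP u\<in>U. SUP s. ennreal (visitation_from \<gamma> (PN + u) \<pi> \<rho> s) / ennreal (\<rho> $ s))"


text \<open>
  Robust policy mirror descent. The map \<open>G k s\<close> selects the subgradients of \<open>w\<close> used at iteration \<open>k\<close>
  in state \<open>s\<close>; if \<open>w\<close> is not differentiable they may have to differ between iterations, even
  when the iterate does not move. The last conjunct is the first-order optimality condition of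
  the update, which for differentiable \<open>w\<close> follows from the minimality of the iterate.
\<close>

definition rpmd ::
  "('s \<Rightarrow> 'a \<Rightarrow> real) \<Rightarrow> real \<Rightarrow> real^'s^'a^'s \<Rightarrow> (real^'s^'a^'s) set \<Rightarrow>
   (real^'a \<Rightarrow> real) \<Rightarrow> (nat \<Rightarrow> 's \<Rightarrow> real^'a \<Rightarrow> real^'a) \<Rightarrow> (nat \<Rightarrow> real) \<Rightarrow> (nat \<Rightarrow> real^'a^'s) \<Rightarrow> bool" where
  "rpmd c \<gamma> PN U w G \<eta> \<pi> \<longleftrightarrow> \<pi> 0 \<in> policies \<and>
     (\<forall>k s. is_arg_min
        (\<lambda>p. \<eta> k * (robust_Q c \<gamma> PN U (\<pi> k) $ s \<bullet> p) + bregman w (G k s) p (\<pi> k $ s))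
        (\<lambda>p. p \<in> prob_simplex) (\<pi> (Suc k) $ s)) \<and>
     (\<forall>k s. \<forall>p\<in>prob_simplex.
        (\<eta> k *\<^sub>R robust_Q c \<gamma> PN U (\<pi> k) $ s + G (Suc k) s (\<pi> (Suc k) $ s) - G k s (\<pi> k $ s))
          \<bullet> (p - \<pi> (Suc k) $ s) \<ge> 0)"

end

theory Submission
  imports Defs
begin

text \<open>
  Let \<open>u\<^sub>j\<close> be a worst perturbation for \<open>\<pi>\<^sub>j\<close>, \<open>V\<^sub>j\<close> the robust value of \<open>\<pi>\<^sub>j\<close>, and \<open>d\<^sub>j\<close> the
  visitation measure of \<open>\<pi>\<^sup>*\<close> under \<open>u\<^sub>j\<close>. The performance difference under \<open>u\<^sub>j\<close> and the three-point
  identity of mirror descent bound \<open>(1 - \<gamma>) (f \<pi>\<^sub>j - f \<pi>\<^sup>*)\<close> by a telescoping term with factor \<open>M\<close> plus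
  \<open>1/\<eta>\<close> times the \<open>d\<^sub>j\<close>-average of the decrease of \<open>D(\<pi>\<^sup>*, \<pi>\<^sub>j)\<close>. As \<open>d\<^sub>j\<close> moves with \<open>j\<close>, summation by
  parts leaves the error \<open>\<Sum>\<^sub>j \<parallel>d\<^sub>j\<^sub>+\<^sub>1 - d\<^sub>j\<parallel>\<close>. Strong convexity of the ambiguity sets makes the
  worst kernel a Lipschitz function of the value, so this error is at most a constant times
  \<open>\<Sum>\<^sub>j \<parallel>V\<^sub>j\<^sub>+\<^sub>1 - V\<^sub>j\<parallel>\<close>, which telescopes because the values decrease monotonically.

  This gives a bound of order \<open>1/k\<close>. It implies the claimed one of order \<open>1/\<surd>k\<close> when \<open>\<eta> k > \<mu> / 2\<close>;
  otherwise the term with \<open>D\<^sub>w \<ge> \<mu> / 2\<close> alone exceeds \<open>1 / (1 - \<gamma>)\<close>, hence the left-hand side.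
\<close>

section \<open>Law of the trajectory\<close>

text \<open>The law of the state-action pair at time \<open>n\<close>, computed by forward
  recursion. That it is the corresponding marginal of \<open>trajectory\<close> is
  \<open>emeasure_trajectory\<close>; from there on all computations with trajectories become finite
  sums.\<close>

primrec occupancy ::
  "real^'a^'s \<Rightarrow> real^'s^'a^'s \<Rightarrow> ('s \<times> 'a \<Rightarrow> real) \<Rightarrow> nat \<Rightarrow> 's \<times> 'a \<Rightarrow> real" where
  "occupancy \<pi> P init 0 = init"
| "occupancy \<pi> P init (Suc n) =
     (\<lambda>(s', a'). (\<Sum>(s, a)\<in>UNIV. occupancy \<pi> P init n (s, a) * P $ s $ a $ s') * \<pi> $ s' $ a')"

lemma nn_integral_step_law:
  fixes \<pi> :: "real^'a::finite^'s::finite" and f :: "'s \<times> 'a \<Rightarrow> ennreal"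
  shows "(\<integral>\<^sup>+ x. f x \<partial>step_law \<pi> P init n \<omega>) = (\<Sum>(s', a')\<in>UNIV. ennreal
     (case n of 0 \<Rightarrow> init (s', a')
      | Suc m \<Rightarrow> P $ fst (\<omega> m) $ snd (\<omega> m) $ s' * \<pi> $ s' $ a') * f (s', a'))"
  unfolding step_law_def
  by (subst nn_integral_point_measure_finite) (auto simp: case_prod_beta)

context
  fixes \<pi> :: "real^'a::finite^'s::finite" and P :: "real^'s^'a^'s" and init :: "'s \<times> 'a \<Rightarrow> real"
  assumes \<pi>: "\<pi> \<in> policies" and P: "P \<in> kernels"
    and init: "\<And>x. 0 \<le> init x" "(\<Sum>x\<in>UNIV. init x) = 1"
begin

interpretation IT: Ionescu_Tulcea "step_law \<pi> P init" "\<lambda>_. count_space UNIV"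
  by (rule Ionescu_Tulcea_step_law[OF \<pi> P init])

lemma occupancy_nonneg: "0 \<le> occupancy \<pi> P init n x"
  using \<pi> P init
  by (induction n arbitrary: x)
    (auto simp: policies_def kernels_def prob_simplex_def split: prod.split intro!: mult_nonneg_nonneg sum_nonneg)

text \<open>\<open>IT.C 0 (Suc n)\<close> is \<open>IT.C 0 n\<close> bound with the extension kernel
  \<open>IT.eP n\<close>, which appends a coordinate distributed as \<open>step_law\<close>.\<close>

lemma nn_integral_C_Suc:
  fixes f :: "'s \<times> 'a \<Rightarrow> ennreal"
  shows "(\<integral>\<^sup>+\<omega>. f (\<omega> n) \<partial>IT.C 0 (Suc n) (\<lambda>_. undefined)) =
    (\<integral>\<^sup>+\<omega>. (\<integral>\<^sup>+ x. f x \<partial>step_law \<pi> P init n \<omega>) \<partial>IT.C 0 n (\<lambda>_. undefined))"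
proof -
  have sp: "(\<lambda>_. undefined) \<in> space (PiM {0..<0} (\<lambda>_. count_space (UNIV :: ('s \<times> 'a) set)))"
    by (simp add: space_PiM PiE_iff extensional_def)
  have m: "(\<lambda>\<omega>. f (\<omega> n)) \<in> borel_measurable (PiM {0..<Suc n} (\<lambda>_. count_space (UNIV :: ('s \<times> 'a) set)))"
    by (rule measurable_compose[OF measurable_component_singleton]) auto
  have eP: "IT.eP n \<in> measurable (IT.C 0 n (\<lambda>_. undefined)) (subprob_algebra (PiM {0..<Suc n} (\<lambda>_. count_space UNIV)))"
    using IT.measurable_eP[of n] IT.sets_C[OF sp, of n] by (simp cong: measurable_cong_sets)
  have "(\<integral>\<^sup>+\<omega>. f (\<omega> n) \<partial>IT.C 0 (Suc n) (\<lambda>_. undefined)) =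
    (\<integral>\<^sup>+\<omega>. (\<integral>\<^sup>+ \<omega>'. f (\<omega>' n) \<partial>IT.eP n \<omega>) \<partial>IT.C 0 n (\<lambda>_. undefined))"
    using nn_integral_bind[OF m eP] by simp
  also have "\<dots> = (\<integral>\<^sup>+\<omega>. (\<integral>\<^sup>+ x. f x \<partial>step_law \<pi> P init n \<omega>) \<partial>IT.C 0 n (\<lambda>_. undefined))"
    using IT.space_C[OF sp, of n] m by (intro nn_integral_cong) (simp add: IT.nn_integral_eP)
  finally show ?thesis .
qed

text \<open>The induction needs all \<open>f\<close> at once: integrating out the last pair replaces
  \<open>f\<close> at time \<open>Suc n\<close> by its one-step average \<open>g\<close> at time
  \<open>n\<close>.\<close>

lemma nn_integral_C_occupancy:
  "(\<integral>\<^sup>+\<omega>. f (\<omega> n) \<partial>IT.C 0 (Suc n) (\<lambda>_. undefined)) = (\<Sum>x\<in>UNIV. ennreal (occupancy \<pi> P init n x) * f x)"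
proof (induction n arbitrary: f)
  case 0
  show ?case
    unfolding nn_integral_C_Suc
    using prob_space.emeasure_space_1[OF IT.prob_space_C[of "\<lambda>_. undefined" 0 0]]
    by (simp add: nn_integral_step_law case_prod_beta space_PiM)
next
  case (Suc n)
  define g where "g y = (\<Sum>(s', a')\<in>UNIV. ennreal (P $ fst y $ snd y $ s' * \<pi> $ s' $ a') * f (s', a'))" for y
  have nn: "0 \<le> P $ s $ a $ s' * \<pi> $ s' $ a'" for s a s' a'
    using \<pi> P by (auto simp: policies_def kernels_def prob_simplex_def)
  have "(\<integral>\<^sup>+\<omega>. f (\<omega> (Suc n)) \<partial>IT.C 0 (Suc (Suc n)) (\<lambda>_. undefined)) =
    (\<integral>\<^sup>+\<omega>. g (\<omega> n) \<partial>IT.C 0 (Suc n) (\<lambda>_. undefined))"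
    unfolding nn_integral_C_Suc[where f = f and n = "Suc n"] by (simp add: nn_integral_step_law g_def del: IT.C.simps)
  also have "\<dots> = (\<Sum>y\<in>UNIV. ennreal (occupancy \<pi> P init n y) * g y)"
    by (rule Suc)
  also have "\<dots> = (\<Sum>y\<in>UNIV. \<Sum>x\<in>UNIV. ennreal (occupancy \<pi> P init n y * (P $ fst y $ snd y $ fst x * \<pi> $ fst x $ snd x)) * f x)"
    unfolding g_def sum_distrib_left
    by (intro sum.cong refl) (auto simp: ennreal_mult' occupancy_nonneg mult.assoc case_prod_beta)
  also have "\<dots> = (\<Sum>x\<in>UNIV. \<Sum>y\<in>UNIV. ennreal (occupancy \<pi> P init n y * (P $ fst y $ snd y $ fst x * \<pi> $ fst x $ snd x)) * f x)"
    by (rule sum.swap)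
  also have "\<dots> = (\<Sum>x\<in>UNIV. ennreal (occupancy \<pi> P init (Suc n) x) * f x)"
    by (intro sum.cong refl)
       (simp add: sum_distrib_right[symmetric] sum_ennreal occupancy_nonneg nn mult_nonneg_nonneg case_prod_beta
         sum_distrib_right mult.assoc)
  finally show ?case .
qed

lemma sets_trajectory: "sets (trajectory \<pi> P init) = sets (PiM UNIV (\<lambda>_. count_space UNIV))"
  unfolding trajectory_def by simp

lemma space_trajectory: "space (trajectory \<pi> P init) = UNIV"
  unfolding trajectory_def by (simp add: space_PiM PiE_iff extensional_def)

text \<open>The event is a cylinder over the window \<open>{0..<Suc n}\<close>, on which the
  projective limit agrees with the finite-horizon measure \<open>IT.C 0 (Suc n)\<close>.\<close>

lemma emeasure_trajectory:
  "emeasure (trajectory \<pi> P init) {\<omega>. \<omega> n \<in> X} = ennreal (\<Sum>x\<in>X. occupancy \<pi> P init n x)"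
proof -
  let ?J = "{0..<Suc n}"
  let ?M = "\<lambda>_. count_space UNIV :: ('s \<times> 'a) measure"
  define A where "A = {\<omega>\<in>space (PiM ?J ?M). \<omega> n \<in> X}"
  have sp: "(\<lambda>_. undefined) \<in> space (PiM {0..<0} ?M)"
    by (simp add: space_PiM PiE_iff extensional_def)
  have A: "A \<in> sets (PiM ?J ?M)"
    unfolding A_def by (auto simp: count_space_PiM_finite)
  have emb: "prod_emb UNIV ?M ?J A = {\<omega>. \<omega> n \<in> X}"
    by (auto simp: prod_emb_def A_def space_PiM)
  have "emeasure (trajectory \<pi> P init) {\<omega>. \<omega> n \<in> X} = emeasure (IT.CI ?J) A"
    unfolding trajectory_def emb[symmetric] by (rule IT.lim[OF _ A]) simp
  also have "\<dots> = emeasure (IT.C 0 (Suc n) (\<lambda>_. undefined)) A"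
    using IT.emeasure_CI[OF order_refl A] sets.sets_into_space[OF A] by (simp add: prod_emb_id space_PiM)
  also have "\<dots> = (\<integral>\<^sup>+\<omega>. indicator A \<omega> \<partial>IT.C 0 (Suc n) (\<lambda>_. undefined))"
    using A IT.sets_C[OF sp, of "Suc n"] by (intro nn_integral_indicator[symmetric]) simp
  also have "\<dots> = (\<integral>\<^sup>+\<omega>. indicator X (\<omega> n) \<partial>IT.C 0 (Suc n) (\<lambda>_. undefined))"
    using IT.space_C[OF sp, of "Suc n"]
    by (intro nn_integral_cong) (simp add: A_def indicator_def del: IT.C.simps)
  also have "\<dots> = ennreal (\<Sum>x\<in>X. occupancy \<pi> P init n x)"
    unfolding nn_integral_C_occupancy 
    by (simp add: sum_ennreal occupancy_nonneg indicator_def if_distrib sum.If_cases cong: if_cong)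
  finally show ?thesis .
qed


lemma prob_space_trajectory: "prob_space (trajectory \<pi> P init)"
  using emeasure_trajectory[of 0 UNIV] init by (intro prob_spaceI) (simp add: space_trajectory)

lemma measure_trajectory:
  "measure (trajectory \<pi> P init) {\<omega>. \<omega> n \<in> X} = (\<Sum>x\<in>X. occupancy \<pi> P init n x)"
  by (simp add: measure_def emeasure_trajectory sum_nonneg occupancy_nonneg)

lemma sum_occupancy: "(\<Sum>x\<in>UNIV. occupancy \<pi> P init n x) = 1"
  using prob_space.prob_space[OF prob_space_trajectory] measure_trajectory[of n UNIV]
  by (simp add: space_trajectory)

lemma measurable_coordinate_trajectory [measurable]:
  "(\<lambda>\<omega>. f (\<omega> n)) \<in> borel_measurable (trajectory \<pi> P init)" for f :: "'s \<times> 'a \<Rightarrow> real"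
  unfolding measurable_cong_sets[OF sets_trajectory refl]
  by (rule measurable_compose[OF measurable_component_singleton]) auto

text \<open>There are finitely many state-action pairs, so the integrand is a finite combination of
  indicators of the events that the pair at time \<open>n\<close> is \<open>x\<close>.\<close>

lemma has_bochner_integral_trajectory:
  fixes f :: "'s \<times> 'a \<Rightarrow> real"
  shows "has_bochner_integral (trajectory \<pi> P init) (\<lambda>\<omega>. f (\<omega> n)) (\<Sum>x\<in>UNIV. occupancy \<pi> P init n x * f x)"
proof -
  interpret prob_space "trajectory \<pi> P init" by (rule prob_space_trajectory)
  have *: "{\<omega>. \<omega> n = x} \<in> sets (trajectory \<pi> P init)" for x
    using measurable_sets[OF measurable_coordinate_trajectory[of "indicator {x}" n], of "{1}"]
    by (simp add: space_trajectory vimage_def indicator_eq_1_iff)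
  have "has_bochner_integral (trajectory \<pi> P init) (\<lambda>\<omega>. \<Sum>x\<in>UNIV. indicator {\<omega>. \<omega> n = x} \<omega> * f x)
    (\<Sum>x\<in>UNIV. measure (trajectory \<pi> P init) {\<omega>. \<omega> n = x} * f x)"
    using * by (intro has_bochner_integral_sum has_bochner_integral_mult_left has_bochner_integral_real_indicator)
      (simp_all add: less_top[symmetric])
  moreover have "(\<Sum>x\<in>UNIV. indicator {\<omega>. \<omega> n = x} \<omega> * f x) = f (\<omega> n)" for \<omega>
    by (simp add: indicator_def if_distrib if_distribR sum.delta cong: if_cong)
  ultimately show ?thesis
    using measure_trajectory[of n "{_}"] by simp
qed

text \<open>Sum and integral may be exchanged because \<open>h\<close> is bounded by some
  \<open>B\<close>, which makes the geometric series with terms \<open>\<gamma> ^ t * B\<close> a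
  dominating one.\<close>

lemma integral_discounted_trajectory:
  fixes h :: "'s \<times> 'a \<Rightarrow> real"
  assumes \<gamma>: "0 < \<gamma>" "\<gamma> < 1"
  shows "(\<integral>\<omega>. (\<Sum>t. \<gamma> ^ t * h (\<omega> t)) \<partial>trajectory \<pi> P init) = (\<Sum>t. \<gamma> ^ t * (\<Sum>x\<in>UNIV. occupancy \<pi> P init t x * h x))"
proof -
  define B where "B = Max (range (\<lambda>x. \<bar>h x\<bar>))"
  have B: "\<bar>h x\<bar> \<le> B" for x
    unfolding B_def by (rule Max_ge) auto
  have int: "has_bochner_integral (trajectory \<pi> P init) (\<lambda>\<omega>. \<gamma> ^ t * h (\<omega> t)) (\<gamma> ^ t * (\<Sum>x\<in>UNIV. occupancy \<pi> P init t x * h x))" for t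
    by (intro has_bochner_integral_mult_right has_bochner_integral_trajectory)
  have abs_int: "has_bochner_integral (trajectory \<pi> P init) (\<lambda>\<omega>. norm (\<gamma> ^ t * h (\<omega> t))) (\<gamma> ^ t * (\<Sum>x\<in>UNIV. occupancy \<pi> P init t x * \<bar>h x\<bar>))" for t
    using has_bochner_integral_mult_right[OF has_bochner_integral_trajectory[of "\<lambda>x. \<bar>h x\<bar>" t], of "\<gamma> ^ t"] \<gamma>
    by (simp add: abs_mult)
  have geo: "summable (\<lambda>t. \<gamma> ^ t * B)"
    using \<gamma> by (intro summable_mult2 summable_geometric) auto
  have "(\<integral>\<omega>. (\<Sum>t. \<gamma> ^ t * h (\<omega> t)) \<partial>trajectory \<pi> P init) = (\<Sum>t. \<integral>\<omega>. \<gamma> ^ t * h (\<omega> t) \<partial>trajectory \<pi> P init)"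
  proof (rule integral_suminf)
    show "AE \<omega> in trajectory \<pi> P init. summable (\<lambda>t. norm (\<gamma> ^ t * h (\<omega> t)))"
      using \<gamma> B by (intro AE_I2 summable_comparison_test'[OF geo]) (auto simp: abs_mult intro!: mult_left_mono)
    have "norm (\<gamma> ^ t * (\<Sum>x\<in>UNIV. occupancy \<pi> P init t x * \<bar>h x\<bar>)) \<le> \<gamma> ^ t * B" for t
    proof -
      have "(\<Sum>x\<in>UNIV. occupancy \<pi> P init t x * \<bar>h x\<bar>) \<le> (\<Sum>x\<in>UNIV. occupancy \<pi> P init t x * B)"
        by (intro sum_mono mult_left_mono B occupancy_nonneg)
      also have "\<dots> = B"
        by (simp add: sum_distrib_right[symmetric] sum_occupancy)
      finally show ?thesis
        using \<gamma> by (simp add: abs_mult sum_nonneg occupancy_nonneg)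
    qed
    then show "summable (\<lambda>t. \<integral>\<omega>. norm (\<gamma> ^ t * h (\<omega> t)) \<partial>trajectory \<pi> P init)"
      unfolding has_bochner_integral_integral_eq[OF abs_int] by (intro summable_comparison_test'[OF geo])
  qed (use int in \<open>auto simp: has_bochner_integral_iff\<close>)
  also have "\<dots> = (\<Sum>t. \<gamma> ^ t * (\<Sum>x\<in>UNIV. occupancy \<pi> P init t x * h x))"
    unfolding has_bochner_integral_integral_eq[OF int] ..
  finally show ?thesis .
qed

end

section \<open>Policy evaluation\<close>

definition state_kernel :: "real^'a^'s \<Rightarrow> real^'s^'a^'s \<Rightarrow> 's \<Rightarrow> 's \<Rightarrow> real" where
  "state_kernel \<pi> P s s' = (\<Sum>a\<in>UNIV. \<pi> $ s $ a * P $ s $ a $ s')"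

text \<open>Duality: instead of pushing the initial law forward \<open>n\<close> steps, the function
  is pulled back \<open>n\<close> steps by the adjoint operator. The right-hand side is linear in
  \<open>init\<close>, so values for different initial laws become averages of one and the same
  function.\<close>

lemma occupancy_backward:
  fixes \<pi> :: "real^'a::finite^'s::finite" and h :: "'s \<times> 'a \<Rightarrow> real"
  shows "(\<Sum>x\<in>UNIV. occupancy \<pi> P init n x * h x) = (\<Sum>y\<in>UNIV. init y *
    ((\<lambda>h y. \<Sum>x\<in>UNIV. P $ fst y $ snd y $ fst x * \<pi> $ fst x $ snd x * h x) ^^ n) h y)"
proof (induction n arbitrary: h)
  case (Suc n)
  have "(\<Sum>x\<in>UNIV. occupancy \<pi> P init (Suc n) x * h x) =
    (\<Sum>x\<in>UNIV. \<Sum>y\<in>UNIV. occupancy \<pi> P init n y * P $ fst y $ snd y $ fst x * \<pi> $ fst x $ snd x * h x)"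
    by (simp add: case_prod_beta sum_distrib_right)
  also have "\<dots> = (\<Sum>y\<in>UNIV. occupancy \<pi> P init n y * (\<Sum>x\<in>UNIV. P $ fst y $ snd y $ fst x * \<pi> $ fst x $ snd x * h x))"
    by (subst sum.swap) (simp add: sum_distrib_left mult.assoc)
  finally show ?case
    unfolding Suc by (simp only: funpow_Suc_right o_apply)
qed simp

lemma sum_UNIV_prod: "(\<Sum>x\<in>UNIV. f x) = (\<Sum>s\<in>UNIV. \<Sum>a\<in>UNIV. f (s, a))"
  for f :: "'s::finite \<times> 'a::finite \<Rightarrow> real"
  by (simp add: sum.cartesian_product)

lemma start_state_distribution:
  fixes \<pi> :: "real^'a::finite^'s::finite"
  assumes "\<pi> \<in> policies"
  shows "0 \<le> start_state \<pi> s x" "(\<Sum>x\<in>UNIV. start_state \<pi> s x) = 1"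
proof -
  show "0 \<le> start_state \<pi> s x"
    using assms by (auto simp: start_state_def policies_def prob_simplex_def split: prod.split)
  have "(\<Sum>x\<in>UNIV. start_state \<pi> s x) = (\<Sum>s'\<in>UNIV. if s' = s then \<Sum>a\<in>UNIV. \<pi> $ s' $ a else 0)"
    unfolding sum_UNIV_prod by (intro sum.cong) (auto simp: start_state_def)
  then show "(\<Sum>x\<in>UNIV. start_state \<pi> s x) = 1"
    using assms by (simp add: policies_def prob_simplex_def)
qed

lemma start_pair_distribution:
  "0 \<le> start_pair s a x" "(\<Sum>x\<in>UNIV. start_pair s a x) = 1" for s :: "'s::finite" and a :: "'a::finite"
  by (auto simp: start_pair_def)

context
  fixes \<pi> :: "real^'a::finite^'s::finite" and P :: "real^'s^'a^'s" and \<gamma> :: real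
  assumes \<pi>: "\<pi> \<in> policies" and P: "P \<in> kernels" and \<gamma>: "0 < \<gamma>" "\<gamma> < 1"
begin

lemma policy_nonneg: "0 \<le> \<pi> $ s $ a" and policy_sum: "(\<Sum>a\<in>UNIV. \<pi> $ s $ a) = 1"
  using \<pi> by (auto simp: policies_def prob_simplex_def)

lemma kernel_nonneg: "0 \<le> P $ s $ a $ s'" and kernel_sum: "(\<Sum>s'\<in>UNIV. P $ s $ a $ s') = 1"
  using P by (auto simp: kernels_def prob_simplex_def)

lemma state_kernel_nonneg: "0 \<le> state_kernel \<pi> P s s'"
  unfolding state_kernel_def by (intro sum_nonneg mult_nonneg_nonneg policy_nonneg kernel_nonneg)

lemma state_kernel_sum: "(\<Sum>s'\<in>UNIV. state_kernel \<pi> P s s') = 1"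
  unfolding state_kernel_def
  by (subst sum.swap) (simp add: sum_distrib_left[symmetric] kernel_sum policy_sum)

text \<open>At a state where \<open>z\<close> takes its maximum \<open>m\<close>, the hypothesis
  reads \<open>m \<le> \<gamma> * m\<close>, since \<open>state_kernel\<close> averages. All later
  comparisons of value functions rest on this.\<close>

lemma maximum_principle:
  assumes z: "\<And>s. z s \<le> \<gamma> * (\<Sum>s'\<in>UNIV. state_kernel \<pi> P s s' * z s')"
  shows "z s \<le> 0"
proof -
  define m where "m = Max (range z)"
  have le: "z s \<le> m" for s
    unfolding m_def by (rule Max_ge) auto
  have "m \<in> range z"
    unfolding m_def by (rule Max_in) auto
  then obtain s0 where s0: "z s0 = m" by auto
  have "(\<Sum>s'\<in>UNIV. state_kernel \<pi> P s0 s' * z s') \<le> (\<Sum>s'\<in>UNIV. state_kernel \<pi> P s0 s' * m)"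
    by (intro sum_mono mult_left_mono le state_kernel_nonneg)
  also have "\<dots> = m"
    by (simp add: sum_distrib_right[symmetric] state_kernel_sum)
  finally have "m \<le> \<gamma> * m"
    using z[of s0] s0 \<gamma> by (smt (verit) mult_left_mono)
  then have "m * (1 - \<gamma>) \<le> 0" by (simp add: algebra_simps)
  then have "m \<le> 0" using \<gamma> by (simp add: mult_le_0_iff)
  then show ?thesis using le[of s] by simp
qed

text \<open>Both values are averages over the initial law of the same function \<open>q\<close>, the
  discounted series of pulled-back costs. Splitting off the head of this series gives the
  fixed-point equation of \<open>q\<close>, and with it both identities.\<close>

lemma action_value_state_value:
  fixes c :: "'s \<Rightarrow> 'a \<Rightarrow> real"
  shows "state_value c \<gamma> P \<pi> s = (\<Sum>a\<in>UNIV. \<pi> $ s $ a * action_value c \<gamma> P \<pi> s a)" (is ?V)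
    and "action_value c \<gamma> P \<pi> s a = c s a + \<gamma> * (\<Sum>s'\<in>UNIV. P $ s $ a $ s' * state_value c \<gamma> P \<pi> s')" (is ?Q)
proof -
  define B where "B h y = (\<Sum>x\<in>UNIV. P $ fst y $ snd y $ fst x * \<pi> $ fst x $ snd x * h x)" for h :: "'s \<times> 'a \<Rightarrow> real" and y
  define h where "h x = c (fst x) (snd x)" for x
  define b where "b = Max (range (\<lambda>x. \<bar>h x\<bar>))"
  have b0: "\<bar>h x\<bar> \<le> b" for x
    unfolding b_def by (rule Max_ge) auto
  have stoch: "(\<Sum>x\<in>UNIV. P $ fst y $ snd y $ fst x * \<pi> $ fst x $ snd x) = 1" for y :: "'s \<times> 'a"
    by (simp add: sum_UNIV_prod sum_distrib_left[symmetric] kernel_sum policy_sum)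
  \<comment> \<open>The backward operator averages, so its iterates keep the bound on the costs and
    the discounted series converges.\<close>
  have b: "\<bar>(B ^^ n) h y\<bar> \<le> b" for n y
  proof (induction n arbitrary: y)
    case (Suc n)
    have "\<bar>(B ^^ Suc n) h y\<bar> \<le> (\<Sum>x\<in>UNIV. \<bar>P $ fst y $ snd y $ fst x * \<pi> $ fst x $ snd x * (B ^^ n) h x\<bar>)"
      by (simp add: B_def)
    also have "\<dots> \<le> (\<Sum>x\<in>UNIV. P $ fst y $ snd y $ fst x * \<pi> $ fst x $ snd x * b)"
      by (intro sum_mono) (auto simp: abs_mult kernel_nonneg policy_nonneg intro!: mult_left_mono Suc)
    also have "\<dots> = b"
      by (simp add: sum_distrib_right[symmetric] stoch)
    finally show ?case .
  qed (simp add: b0)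
  have sm: "summable (\<lambda>t. \<gamma> ^ t * (B ^^ t) h y)" for y
  proof (rule summable_comparison_test')
    show "summable (\<lambda>t. \<gamma> ^ t * b)"
      using \<gamma> by (intro summable_mult2 summable_geometric) auto
    show "norm (\<gamma> ^ n * (B ^^ n) h y) \<le> \<gamma> ^ n * b" for n
      using \<gamma> b[of n y] by (simp add: abs_mult mult_left_mono)
  qed
  define q where "q y = (\<Sum>t. \<gamma> ^ t * (B ^^ t) h y)" for y
  have integral: "(\<integral>\<omega>. (\<Sum>t. \<gamma> ^ t * c (fst (\<omega> t)) (snd (\<omega> t))) \<partial>trajectory \<pi> P init) = (\<Sum>y\<in>UNIV. init y * q y)"
    if init: "\<And>x. 0 \<le> init x" "(\<Sum>x\<in>UNIV. init x) = 1" for init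
  proof -
    have "(\<integral>\<omega>. (\<Sum>t. \<gamma> ^ t * c (fst (\<omega> t)) (snd (\<omega> t))) \<partial>trajectory \<pi> P init) =
      (\<Sum>t. \<gamma> ^ t * (\<Sum>y\<in>UNIV. init y * (B ^^ t) h y))"
      using integral_discounted_trajectory[OF \<pi> P init \<gamma>, of h] occupancy_backward[of \<pi> P init _ h]
      by (simp add: h_def B_def[abs_def])
    also have "\<dots> = (\<Sum>t. \<Sum>y\<in>UNIV. init y * (\<gamma> ^ t * (B ^^ t) h y))"
      by (simp add: sum_distrib_left algebra_simps)
    also have "\<dots> = (\<Sum>y\<in>UNIV. init y * q y)"
      unfolding q_def using sm by (subst suminf_sum) (auto simp: suminf_mult intro: summable_mult)
    finally show ?thesis .
  qed
  have Q: "action_value c \<gamma> P \<pi> s a = q (s, a)" for s a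
    unfolding action_value_def integral[OF start_pair_distribution]
    by (subst sum.remove[of _ "(s, a)"]) (auto simp: start_pair_def)
  have V: "state_value c \<gamma> P \<pi> s = (\<Sum>a\<in>UNIV. \<pi> $ s $ a * q (s, a))" for s
    unfolding state_value_def integral[OF start_state_distribution[OF \<pi>]] sum_UNIV_prod
    by (subst sum.remove[of _ s]) (auto simp: start_state_def)
  show ?V
    by (simp add: Q V)
  have "q y = h y + \<gamma> * B q y" for y
  proof -
    have "q y = h y + (\<Sum>t. \<gamma> ^ Suc t * (B ^^ Suc t) h y)"
      unfolding q_def using suminf_split_head[OF sm[of y]] by simp
    also have "(\<Sum>t. \<gamma> ^ Suc t * (B ^^ Suc t) h y) = (\<Sum>t. \<Sum>x\<in>UNIV. \<gamma> * (P $ fst y $ snd y $ fst x * \<pi> $ fst x $ snd x) * (\<gamma> ^ t * (B ^^ t) h x))"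
      by (simp add: B_def sum_distrib_left algebra_simps)
    also have "\<dots> = (\<Sum>x\<in>UNIV. \<gamma> * (P $ fst y $ snd y $ fst x * \<pi> $ fst x $ snd x) * q x)"
      unfolding q_def using sm by (subst suminf_sum) (auto simp: suminf_mult intro: summable_mult)
    finally show ?thesis
      by (simp add: B_def sum_distrib_left mult.assoc)
  qed
  note this[of "(s, a)"]
  moreover have "B q (s, a) = (\<Sum>s'\<in>UNIV. P $ s $ a $ s' * state_value c \<gamma> P \<pi> s')"
    by (simp add: B_def V sum_UNIV_prod sum_distrib_left mult.assoc)
  ultimately show ?Q
    by (simp add: Q h_def)
qed

lemma state_value_Bellman:
  fixes c :: "'s \<Rightarrow> 'a \<Rightarrow> real"
  shows "state_value c \<gamma> P \<pi> s = (\<Sum>a\<in>UNIV. \<pi> $ s $ a * c s a)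
    + \<gamma> * (\<Sum>s'\<in>UNIV. state_kernel \<pi> P s s' * state_value c \<gamma> P \<pi> s')"
proof -
  have "(\<Sum>s'\<in>UNIV. state_kernel \<pi> P s s' * state_value c \<gamma> P \<pi> s') =
    (\<Sum>a\<in>UNIV. \<pi> $ s $ a * (\<Sum>s'\<in>UNIV. P $ s $ a $ s' * state_value c \<gamma> P \<pi> s'))"
    unfolding state_kernel_def sum_distrib_right sum_distrib_left mult.assoc by (rule sum.swap)
  moreover have "state_value c \<gamma> P \<pi> s =
    (\<Sum>a\<in>UNIV. \<pi> $ s $ a * (c s a + \<gamma> * (\<Sum>s'\<in>UNIV. P $ s $ a $ s' * state_value c \<gamma> P \<pi> s')))"
    by (simp only: action_value_state_value(1)[of c s] action_value_state_value(2)[of c s])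
  ultimately show ?thesis
    by (simp add: distrib_left sum.distrib sum_distrib_left mult.left_commute)
qed

text \<open>The maximum principle compares the value with the constants 0 and
  \<open>1 / (1 - \<gamma>)\<close>, which solve the Bellman equation for the extreme costs 0 and
  1.\<close>

lemma state_value_bounds:
  fixes c :: "'s \<Rightarrow> 'a \<Rightarrow> real"
  assumes c: "\<And>s a. 0 \<le> c s a" "\<And>s a. c s a \<le> 1"
  shows "0 \<le> state_value c \<gamma> P \<pi> s" "state_value c \<gamma> P \<pi> s \<le> 1 / (1 - \<gamma>)"
proof -
  let ?v = "state_value c \<gamma> P \<pi>"
  have c0: "0 \<le> (\<Sum>a\<in>UNIV. \<pi> $ s $ a * c s a)" for s
    by (intro sum_nonneg mult_nonneg_nonneg policy_nonneg c)
  have "(\<Sum>a\<in>UNIV. \<pi> $ s $ a * c s a) \<le> (\<Sum>a\<in>UNIV. \<pi> $ s $ a * 1)" for s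
    by (intro sum_mono mult_left_mono policy_nonneg c)
  then have c1: "(\<Sum>a\<in>UNIV. \<pi> $ s $ a * c s a) \<le> 1" for s
    by (simp add: policy_sum)
  have "- ?v s \<le> 0"
  proof (rule maximum_principle)
    show "- ?v s \<le> \<gamma> * (\<Sum>s'\<in>UNIV. state_kernel \<pi> P s s' * - ?v s')" for s
      using state_value_Bellman[of c s] c0[of s] by (simp only: sum_negf mult_minus_right)
  qed
  then show "0 \<le> ?v s" by simp
  have "?v s - 1 / (1 - \<gamma>) \<le> 0"
  proof (rule maximum_principle)
    fix s
    have "(\<Sum>s'\<in>UNIV. state_kernel \<pi> P s s' * (?v s' - 1 / (1 - \<gamma>)))
      = (\<Sum>s'\<in>UNIV. state_kernel \<pi> P s s' * ?v s') - 1 / (1 - \<gamma>)"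
      by (simp add: right_diff_distrib sum_subtractf sum_divide_distrib[symmetric] state_kernel_sum)
    moreover have "1 - 1 / (1 - \<gamma>) = - \<gamma> / (1 - \<gamma>)"
      using \<gamma> by (simp add: field_simps)
    ultimately show "?v s - 1 / (1 - \<gamma>) \<le> \<gamma> * (\<Sum>s'\<in>UNIV. state_kernel \<pi> P s s' * (?v s' - 1 / (1 - \<gamma>)))"
      using c1[of s] by (subst state_value_Bellman) (simp add: right_diff_distrib)
  qed
  then show "?v s \<le> 1 / (1 - \<gamma>)" by simp
qed

section \<open>Discounted visitation measures\<close>

lemma visitation_flow:
  "0 \<le> visitation \<gamma> P \<pi> s s'"
  "visitation \<gamma> P \<pi> s s' = (1 - \<gamma>) * (if s' = s then 1 else 0)
    + \<gamma> * (\<Sum>x\<in>UNIV. visitation \<gamma> P \<pi> s x * state_kernel \<pi> P x s')"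
proof -
  define \<nu> where "\<nu> t s' = measure (trajectory \<pi> P (start_state \<pi> s)) {\<omega>. fst (\<omega> t) = s'}" for t s'
  let ?occ = "occupancy \<pi> P (start_state \<pi> s)"
  note init = start_state_distribution[OF \<pi>, of s]
  have \<nu>: "\<nu> t s' = (\<Sum>a\<in>UNIV. ?occ t (s', a))" for t s'
  proof -
    have "\<nu> t s' = (\<Sum>x\<in>{x. fst x = s'}. ?occ t x)"
      using measure_trajectory[OF \<pi> P init, of t "{x. fst x = s'}"] by (simp add: \<nu>_def)
    also have "{x. fst x = s'} = Pair s' ` UNIV"
      by auto
    finally show ?thesis
      by (simp add: sum.reindex inj_on_def)
  qed
  have \<nu>_bounds: "0 \<le> \<nu> t s'" "\<nu> t s' \<le> 1" for t s'
    using prob_space.prob_le_1[OF prob_space_trajectory[OF \<pi> P init]] by (auto simp: \<nu>_def)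
  have \<nu>_0: "\<nu> 0 s' = (if s' = s then 1 else 0)" for s'
    unfolding \<nu> by (simp add: start_state_def policy_sum)
  \<comment> \<open>The factorization holds at time 0 too, because \<open>start_state\<close> draws
    the first action from \<open>\<pi>\<close>. It is what makes the state marginals a Markov chain
    with kernel \<open>state_kernel \<pi> P\<close>.\<close>
  have occ: "?occ t (s', a) = \<nu> t s' * \<pi> $ s' $ a" for t s' a
  proof (cases t)
    case 0
    then show ?thesis by (simp add: \<nu>_0 start_state_def)
  next
    case (Suc n)
    then show ?thesis
      unfolding \<nu> by (simp add: sum_distrib_left[symmetric] policy_sum)
  qed
  have \<nu>_Suc: "\<nu> (Suc t) s' = (\<Sum>x\<in>UNIV. \<nu> t x * state_kernel \<pi> P x s')" for t s'
  proof -
    have "\<nu> (Suc t) s' = (\<Sum>(x, a)\<in>UNIV. ?occ t (x, a) * P $ x $ a $ s')"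
      unfolding \<nu> by (simp add: sum_distrib_left[symmetric] policy_sum)
    also have "\<dots> = (\<Sum>x\<in>UNIV. \<nu> t x * state_kernel \<pi> P x s')"
      by (simp add: sum_UNIV_prod occ state_kernel_def sum_distrib_left mult.assoc)
    finally show ?thesis .
  qed
  have sm: "summable (\<lambda>t. \<gamma> ^ t * \<nu> t s')" for s'
  proof (rule summable_comparison_test')
    show "summable (\<lambda>t. \<gamma> ^ t)"
      using \<gamma> by (intro summable_geometric) auto
    show "norm (\<gamma> ^ n * \<nu> n s') \<le> \<gamma> ^ n" for n
      using \<gamma> \<nu>_bounds[of n s'] by (simp add: abs_mult mult_left_le)
  qed
  have d: "visitation \<gamma> P \<pi> s s' = (1 - \<gamma>) * (\<Sum>t. \<gamma> ^ t * \<nu> t s')" for s'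
    by (simp add: visitation_def \<nu>_def)
  show "0 \<le> visitation \<gamma> P \<pi> s s'"
    unfolding d using \<gamma> \<nu>_bounds sm by (auto intro!: mult_nonneg_nonneg suminf_nonneg)
  \<comment> \<open>The time-0 term yields the point mass at \<open>s\<close>; the rest is the same
    series moved by one transition and discounted once.\<close>
  have "(\<Sum>t. \<gamma> ^ t * \<nu> t s') = (\<Sum>t. \<gamma> ^ Suc t * \<nu> (Suc t) s') + \<nu> 0 s'"
    using suminf_split_head[OF sm[of s']] by simp
  also have "(\<Sum>t. \<gamma> ^ Suc t * \<nu> (Suc t) s') = (\<Sum>t. \<Sum>x\<in>UNIV. \<gamma> * state_kernel \<pi> P x s' * (\<gamma> ^ t * \<nu> t x))"
    by (simp add: \<nu>_Suc sum_distrib_left algebra_simps)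
  also have "\<dots> = (\<Sum>x\<in>UNIV. \<gamma> * state_kernel \<pi> P x s' * (\<Sum>t. \<gamma> ^ t * \<nu> t x))"
    using sm by (subst suminf_sum) (auto simp: suminf_mult intro: summable_mult)
  finally show "visitation \<gamma> P \<pi> s s' = (1 - \<gamma>) * (if s' = s then 1 else 0)
    + \<gamma> * (\<Sum>x\<in>UNIV. visitation \<gamma> P \<pi> s x * state_kernel \<pi> P x s')"
    unfolding d \<nu>_0 by (simp add: distrib_left sum_distrib_left algebra_simps)
qed

lemma visitation_from_flow:
  "visitation_from \<gamma> P \<pi> \<rho> s' = (1 - \<gamma>) * \<rho> $ s'
    + \<gamma> * (\<Sum>x\<in>UNIV. visitation_from \<gamma> P \<pi> \<rho> x * state_kernel \<pi> P x s')"
proof -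
  have "visitation_from \<gamma> P \<pi> \<rho> s' = (\<Sum>s\<in>UNIV. \<rho> $ s * ((1 - \<gamma>) * (if s' = s then 1 else 0)
    + \<gamma> * (\<Sum>x\<in>UNIV. visitation \<gamma> P \<pi> s x * state_kernel \<pi> P x s')))"
    unfolding visitation_from_def by (subst visitation_flow(2)) simp
  also have "\<dots> = (\<Sum>s\<in>UNIV. \<rho> $ s * ((1 - \<gamma>) * (if s' = s then 1 else 0))) +
    \<gamma> * (\<Sum>s\<in>UNIV. \<Sum>x\<in>UNIV. \<rho> $ s * (visitation \<gamma> P \<pi> s x * state_kernel \<pi> P x s'))"
    by (simp add: distrib_left sum.distrib sum_distrib_left mult_ac)
  also have "(\<Sum>s\<in>UNIV. \<Sum>x\<in>UNIV. \<rho> $ s * (visitation \<gamma> P \<pi> s x * state_kernel \<pi> P x s')) =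
    (\<Sum>x\<in>UNIV. visitation_from \<gamma> P \<pi> \<rho> x * state_kernel \<pi> P x s')"
    unfolding visitation_from_def sum_distrib_right by (subst sum.swap) (simp add: mult.assoc)
  also have "(\<Sum>s\<in>UNIV. \<rho> $ s * ((1 - \<gamma>) * (if s' = s then 1 else 0))) = (1 - \<gamma>) * \<rho> $ s'"
    by (simp add: if_distrib mult.commute cong: if_cong)
  finally show ?thesis .
qed

lemma visitation_from_distribution:
  assumes "\<rho> \<in> prob_simplex"
  shows "0 \<le> visitation_from \<gamma> P \<pi> \<rho> s" "(\<Sum>s\<in>UNIV. visitation_from \<gamma> P \<pi> \<rho> s) = 1"
proof -
  show "0 \<le> visitation_from \<gamma> P \<pi> \<rho> s"
    using assms unfolding visitation_from_def prob_simplex_def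
    by (auto intro!: sum_nonneg mult_nonneg_nonneg visitation_flow)
  let ?d = "visitation_from \<gamma> P \<pi> \<rho>"
  have "(\<Sum>s\<in>UNIV. ?d s) = (1 - \<gamma>) * (\<Sum>s\<in>UNIV. \<rho> $ s)
    + \<gamma> * (\<Sum>s\<in>UNIV. \<Sum>x\<in>UNIV. ?d x * state_kernel \<pi> P x s)"
    by (subst visitation_from_flow) (simp add: sum.distrib sum_distrib_left)
  also have "(\<Sum>s\<in>UNIV. \<Sum>x\<in>UNIV. ?d x * state_kernel \<pi> P x s) = (\<Sum>x\<in>UNIV. ?d x)"
    by (subst sum.swap) (simp add: sum_distrib_left[symmetric] state_kernel_sum)
  finally have "(1 - \<gamma>) * (\<Sum>s\<in>UNIV. ?d s) = 1 - \<gamma>"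
    using assms by (simp add: prob_simplex_def algebra_simps)
  then show "(\<Sum>s\<in>UNIV. ?d s) = 1" using \<gamma> by simp
qed

text \<open>With \<open>K\<close> the state kernel, the flow equation says that the visitation
  measure is \<open>1 - \<gamma>\<close> times \<open>\<rho>\<close> applied to the inverse of
  \<open>I - \<gamma> K\<close>. Pairing it with \<open>I - \<gamma> K\<close> applied to
  \<open>h\<close> cancels the inverse. This turns one-step differences into differences of
  objectives.\<close>

lemma visitation_from_resolvent:
  "(\<Sum>s\<in>UNIV. visitation_from \<gamma> P \<pi> \<rho> s * (h s - \<gamma> * (\<Sum>s'\<in>UNIV. state_kernel \<pi> P s s' * h s')))
    = (1 - \<gamma>) * (\<Sum>s\<in>UNIV. \<rho> $ s * h s)"
proof -
  let ?d = "visitation_from \<gamma> P \<pi> \<rho>"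
  have "(\<Sum>s\<in>UNIV. ?d s * h s) = (\<Sum>s\<in>UNIV. ((1 - \<gamma>) * \<rho> $ s
    + \<gamma> * (\<Sum>x\<in>UNIV. ?d x * state_kernel \<pi> P x s)) * h s)"
    by (subst visitation_from_flow) simp
  also have "\<dots> = (1 - \<gamma>) * (\<Sum>s\<in>UNIV. \<rho> $ s * h s) + \<gamma> * (\<Sum>s\<in>UNIV. \<Sum>x\<in>UNIV. ?d x * (state_kernel \<pi> P x s * h s))"
    by (simp add: distrib_right sum.distrib sum_distrib_left sum_distrib_right mult.assoc)
  also have "(\<Sum>s\<in>UNIV. \<Sum>x\<in>UNIV. ?d x * (state_kernel \<pi> P x s * h s)) = (\<Sum>x\<in>UNIV. ?d x * (\<Sum>s\<in>UNIV. state_kernel \<pi> P x s * h s))"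
    by (subst sum.swap) (simp add: sum_distrib_left)
  finally show ?thesis
    by (simp add: right_diff_distrib sum_subtractf sum_distrib_left mult_ac)
qed

end

text \<open>Subtracting the two flow equations, the difference \<open>e\<close> satisfies
  \<open>e = \<gamma> (e K + d' (K - K'))\<close>. In the 1-norm \<open>K\<close> does not expand
  and \<open>d'\<close> has mass one, so the norm of \<open>e\<close> is at most
  \<open>\<gamma>\<close> times itself plus \<open>\<gamma> * B\<close>.\<close>

lemma visitation_from_kernel_perturbation:
  fixes \<pi> :: "real^'a::finite^'s::finite" and P P' :: "real^'s^'a^'s"
  assumes \<pi>: "\<pi> \<in> policies" and P: "P \<in> kernels" and P': "P' \<in> kernels" and \<gamma>: "0 < \<gamma>" "\<gamma> < 1"
    and \<rho>: "\<rho> \<in> prob_simplex"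
    and B: "\<And>s a. norm1 (P $ s $ a - P' $ s $ a) \<le> B"
  shows "(\<Sum>s\<in>UNIV. \<bar>visitation_from \<gamma> P \<pi> \<rho> s - visitation_from \<gamma> P' \<pi> \<rho> s\<bar>) \<le> \<gamma> * B / (1 - \<gamma>)"
proof -
  let ?d = "visitation_from \<gamma> P \<pi> \<rho>" and ?d' = "visitation_from \<gamma> P' \<pi> \<rho>"
  let ?K = "state_kernel \<pi> P" and ?K' = "state_kernel \<pi> P'"
  define e where "e s = ?d s - ?d' s" for s
  have K: "(\<Sum>s\<in>UNIV. \<bar>?K x s - ?K' x s\<bar>) \<le> B" for x
  proof -
    have "(\<Sum>s\<in>UNIV. \<bar>?K x s - ?K' x s\<bar>) = (\<Sum>s\<in>UNIV. \<bar>\<Sum>a\<in>UNIV. \<pi> $ x $ a * (P $ x $ a $ s - P' $ x $ a $ s)\<bar>)"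
      by (simp add: state_kernel_def right_diff_distrib sum_subtractf)
    also have "\<dots> \<le> (\<Sum>s\<in>UNIV. \<Sum>a\<in>UNIV. \<pi> $ x $ a * \<bar>P $ x $ a $ s - P' $ x $ a $ s\<bar>)"
      by (intro sum_mono order_trans[OF sum_abs]) (simp add: abs_mult policy_nonneg[OF \<pi> P \<gamma>])
    also have "\<dots> = (\<Sum>a\<in>UNIV. \<pi> $ x $ a * norm1 (P $ x $ a - P' $ x $ a))"
      by (subst sum.swap) (simp add: norm1_def sum_distrib_left)
    also have "\<dots> \<le> (\<Sum>a\<in>UNIV. \<pi> $ x $ a * B)"
      by (intro sum_mono mult_left_mono B policy_nonneg[OF \<pi> P \<gamma>])
    also have "\<dots> = B"
      by (simp add: sum_distrib_right[symmetric] policy_sum[OF \<pi> P \<gamma>])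
    finally show ?thesis .
  qed
  have e: "e s = \<gamma> * (\<Sum>x\<in>UNIV. e x * ?K x s + ?d' x * (?K x s - ?K' x s))" for s
  proof -
    have "e s = \<gamma> * (\<Sum>x\<in>UNIV. ?d x * ?K x s) - \<gamma> * (\<Sum>x\<in>UNIV. ?d' x * ?K' x s)"
      unfolding e_def visitation_from_flow[OF \<pi> P \<gamma>, of \<rho> s] visitation_from_flow[OF \<pi> P' \<gamma>, of \<rho> s] by simp
    also have "\<dots> = \<gamma> * (\<Sum>x\<in>UNIV. e x * ?K x s + ?d' x * (?K x s - ?K' x s))"
      by (simp add: right_diff_distrib[symmetric] sum_subtractf[symmetric]) (simp add: e_def algebra_simps)
    finally show ?thesis .
  qed
  have "(\<Sum>s\<in>UNIV. \<bar>e s\<bar>) \<le> (\<Sum>s\<in>UNIV. \<gamma> * (\<Sum>x\<in>UNIV. \<bar>e x\<bar> * ?K x s + ?d' x * \<bar>?K x s - ?K' x s\<bar>))"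
  proof (rule sum_mono)
    fix s
    have "\<bar>e s\<bar> \<le> \<gamma> * (\<Sum>x\<in>UNIV. \<bar>e x * ?K x s + ?d' x * (?K x s - ?K' x s)\<bar>)"
      using \<gamma> by (subst e) (auto simp: abs_mult intro!: mult_left_mono)
    also have "\<dots> \<le> \<gamma> * (\<Sum>x\<in>UNIV. \<bar>e x\<bar> * ?K x s + ?d' x * \<bar>?K x s - ?K' x s\<bar>)"
      using \<gamma> by (intro mult_left_mono sum_mono order_trans[OF abs_triangle_ineq])
        (simp_all add: abs_mult state_kernel_nonneg[OF \<pi> P \<gamma>] visitation_from_distribution[OF \<pi> P' \<gamma> \<rho>])
    finally show "\<bar>e s\<bar> \<le> \<gamma> * (\<Sum>x\<in>UNIV. \<bar>e x\<bar> * ?K x s + ?d' x * \<bar>?K x s - ?K' x s\<bar>)" .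
  qed
  also have "\<dots> = \<gamma> * (\<Sum>x\<in>UNIV. \<bar>e x\<bar> * (\<Sum>s\<in>UNIV. ?K x s) + ?d' x * (\<Sum>s\<in>UNIV. \<bar>?K x s - ?K' x s\<bar>))"
    unfolding sum_distrib_left[symmetric]
    by (subst sum.swap) (simp add: sum_distrib_left sum.distrib)
  also have "\<dots> \<le> \<gamma> * (\<Sum>x\<in>UNIV. \<bar>e x\<bar> + ?d' x * B)"
    using \<gamma> by (intro mult_left_mono sum_mono add_mono)
      (simp_all add: state_kernel_sum[OF \<pi> P \<gamma>] K mult_left_mono visitation_from_distribution[OF \<pi> P' \<gamma> \<rho>])
  also have "\<dots> = \<gamma> * (\<Sum>x\<in>UNIV. \<bar>e x\<bar>) + \<gamma> * B"
    by (simp add: sum.distrib sum_distrib_right[symmetric] visitation_from_distribution[OF \<pi> P' \<gamma> \<rho>] distrib_left)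
  finally have "(\<Sum>s\<in>UNIV. \<bar>e s\<bar>) * (1 - \<gamma>) \<le> \<gamma> * B"
    by (simp add: algebra_simps)
  then show ?thesis
    using \<gamma> by (simp add: e_def pos_le_divide_eq)
qed

section \<open>Maximizers over strongly convex sets\<close>

lemma norm1_le_norm: "norm1 x \<le> real CARD('n) * norm x" for x :: "real^'n"
  unfolding norm1_def using sum_bounded_above[of UNIV "\<lambda>i. \<bar>x $ i\<bar>" "norm x"]
  by (simp add: component_le_norm_cart)

lemma norm_le_norm1: "norm x \<le> norm1 x" for x :: "real^'n"
  unfolding norm1_def using norm_le_l1_cart[of x] by simp

text \<open>Quadratic growth of a linear functional away from its maximizer. From the point dividing
  the segment from \<open>q\<close> to \<open>p\<close>, a step of length \<open>\<delta>\<close> in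
  direction \<open>x\<close> stays in \<open>C\<close> by strong convexity. Comparison with the
  maximum, division by \<open>1 - t\<close> and the passage of \<open>t\<close> to 1 give the
  claim.\<close>

lemma rel_strongly_convex_maximizer:
  fixes C :: "(real^'n) set"
  assumes C: "rel_strongly_convex R C" "R > 0" and hull: "affine hull C = {q. (\<Sum>i\<in>UNIV. q $ i) = 1}"
    and x: "x \<in> zero_sum_space" and p: "p \<in> C" "\<forall>q\<in>C. x \<bullet> q \<le> x \<bullet> p" and q: "q \<in> C"
  shows "norm x * (norm (p - q))\<^sup>2 / (2 * R) \<le> x \<bullet> (p - q)"
proof (cases "x = 0")
  case False
  show ?thesis
  proof (rule field_le_mult_one_interval)
    fix t :: real
    assume t: "0 < t" "t < 1"
    define z where "z = t *\<^sub>R p + (1 - t) *\<^sub>R q"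
    define \<delta> where "\<delta> = t * (1 - t) / (2 * R) * (norm (p - q))\<^sup>2"
    have "p \<in> affine hull C" "q \<in> affine hull C"
      using p q by (auto simp: hull_inc)
    \<comment> \<open>Relative strong convexity only controls the part of the ball inside the affine
      hull; moving along \<open>x\<close> stays there because the coordinates of \<open>x\<close>
      sum to zero.\<close>
    then have z: "z + (\<delta> / norm x) *\<^sub>R x \<in> affine hull C"
      using x unfolding hull z_def zero_sum_space_def
      by (simp add: sum.distrib sum_distrib_left[symmetric] sum_divide_distrib[symmetric] del: sum_distrib_left)
    have "0 \<le> \<delta>"
      unfolding \<delta>_def using t \<open>R > 0\<close> by simp
    then have "z + (\<delta> / norm x) *\<^sub>R x \<in> cball z \<delta>"
      using False by (simp add: dist_norm)
    with z C p q t have "z + (\<delta> / norm x) *\<^sub>R x \<in> C"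
      unfolding rel_strongly_convex_def z_def \<delta>_def by (meson IntI atLeastAtMost_iff less_imp_le subsetD)
    from p(2)[rule_format, OF this] have "x \<bullet> z + \<delta> * norm x \<le> x \<bullet> p"
      using False by (simp add: inner_add_right dot_square_norm power2_eq_square)
    then have "\<delta> * norm x \<le> (1 - t) * (x \<bullet> (p - q))"
      unfolding z_def by (simp add: inner_add_right inner_diff_right algebra_simps)
    then have "(1 - t) * (t * (norm x * (norm (p - q))\<^sup>2 / (2 * R))) \<le> (1 - t) * (x \<bullet> (p - q))"
      unfolding \<delta>_def by (simp add: algebra_simps)
    then show "t * (norm x * (norm (p - q))\<^sup>2 / (2 * R)) \<le> x \<bullet> (p - q)"
      using t by (subst (asm) mult_le_cancel_left_pos) auto
  qed
qed simp

text \<open>Adding the quadratic growth inequalities at \<open>p\<close> and at \<open>q\<close>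
  leaves \<open>(x - y) \<bullet> (p - q)\<close> on the right. Cauchy-Schwarz then allows one
  factor \<open>norm (p - q)\<close> to be cancelled.\<close>

lemma maximizer_Lipschitz:
  fixes C :: "(real^'n) set"
  assumes C: "rel_strongly_convex R C" "R > 0" and hull: "affine hull C = {q. (\<Sum>i\<in>UNIV. q $ i) = 1}"
    and x: "x \<in> zero_sum_space" "y \<in> zero_sum_space" "0 < r" "r \<le> norm x" "r \<le> norm y"
    and p: "p \<in> C" "\<forall>q\<in>C. x \<bullet> q \<le> x \<bullet> p"
    and q: "q \<in> C" "\<forall>p\<in>C. y \<bullet> p \<le> y \<bullet> q"
  shows "norm (p - q) \<le> R / r * norm (x - y)"
proof -
  let ?n = "norm (p - q)"
  have "norm x * ?n\<^sup>2 / (2 * R) + norm y * ?n\<^sup>2 / (2 * R) \<le> x \<bullet> (p - q) + y \<bullet> (q - p)"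
    using rel_strongly_convex_maximizer[OF C hull x(1) p q(1)]
      rel_strongly_convex_maximizer[OF C hull x(2) q p(1)]
    by (simp add: norm_minus_commute)
  also have "\<dots> = (x - y) \<bullet> (p - q)"
    by (simp add: inner_diff_left inner_diff_right)
  also have "\<dots> \<le> norm (x - y) * ?n"
    by (rule norm_cauchy_schwarz)
  finally have "(norm x + norm y) / (2 * R) * ?n\<^sup>2 \<le> norm (x - y) * ?n"
    by (simp add: add_divide_distrib distrib_right)
  moreover have "r / R * ?n\<^sup>2 \<le> (norm x + norm y) / (2 * R) * ?n\<^sup>2"
    using x \<open>R > 0\<close> by (intro mult_right_mono) (auto simp: divide_simps)
  ultimately have "r / R * ?n * ?n \<le> norm (x - y) * ?n"
    by (simp add: power2_eq_square)
  then have "r / R * ?n \<le> norm (x - y)"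
    by (cases "?n = 0") (simp, erule mult_right_le_imp_le, simp)
  then show ?thesis
    using x \<open>R > 0\<close> by (simp add: field_simps)
qed

lemma zero_sum_space_closest_point:
  fixes V :: "real^'n"
  shows "closest_point zero_sum_space V \<in> zero_sum_space"
    and "q \<in> zero_sum_space \<Longrightarrow> V \<bullet> q = closest_point zero_sum_space V \<bullet> q"
    and "norm (closest_point zero_sum_space V - closest_point zero_sum_space W) \<le> norm (V - W)"
proof -
  have eq: "zero_sum_space = {x :: real^'n. (\<chi> i. 1) \<bullet> x = 0}"
    by (simp add: zero_sum_space_def inner_vec_def)
  have sub: "subspace (zero_sum_space :: (real^'n) set)"
    unfolding eq by (rule subspace_hyperplane)
  have closed: "closed (zero_sum_space :: (real^'n) set)"
    by (rule closed_subspace[OF sub])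
  have convex: "convex (zero_sum_space :: (real^'n) set)"
    by (rule subspace_imp_convex[OF sub])
  have ne: "zero_sum_space \<noteq> ({} :: (real^'n) set)"
    using subspace_0[OF sub] by auto
  let ?c = "closest_point zero_sum_space V"
  show c: "?c \<in> zero_sum_space"
    by (rule closest_point_in_set[OF closed ne])
  show "V \<bullet> q = ?c \<bullet> q" if "q \<in> zero_sum_space"
    \<comment> \<open>The variational inequality of the projection, tested on both sides of
      \<open>?c\<close>, becomes an equality: the residual is orthogonal to the subspace.\<close>
    using closest_point_dot[OF convex closed, of "?c + q" V] closest_point_dot[OF convex closed, of "?c - q" V]
      subspace_add[OF sub c that] subspace_diff[OF sub c that]
    by (simp add: inner_diff_left)
  show "norm (?c - closest_point zero_sum_space W) \<le> norm (V - W)"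
    using closest_point_lipschitz[OF convex closed ne, of V W] by (simp add: dist_norm)
qed

text \<open>The affine hull lies in the hyperplane of coordinate sum 1 and has the same dimension,
  hence fills it.\<close>

lemma affine_hull_full_simplex_subset:
  fixes C :: "(real^'n) set"
  assumes "C \<subseteq> prob_simplex" "C \<noteq> {}" "aff_dim C = int CARD('n) - 1"
  shows "affine hull C = {q. (\<Sum>i\<in>UNIV. q $ i) = 1}"
proof -
  have eq: "{q :: real^'n. (\<Sum>i\<in>UNIV. q $ i) = 1} = {q. (\<chi> i. 1) \<bullet> q = 1}"
    by (simp add: inner_vec_def)
  have "(\<chi> i. (1 :: real)) \<noteq> (0 :: real^'n)"
    by (simp add: vec_eq_iff)
  then have "aff_dim {q :: real^'n. (\<Sum>i\<in>UNIV. q $ i) = 1} = int CARD('n) - 1"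
    unfolding eq by (simp add: aff_dim_hyperplane)
  moreover have aff: "affine {q :: real^'n. (\<Sum>i\<in>UNIV. q $ i) = 1}"
    unfolding eq by (rule affine_hyperplane)
  moreover have "affine hull C \<subseteq> {q. (\<Sum>i\<in>UNIV. q $ i) = 1}"
    using assms(1) aff by (intro hull_minimal) (auto simp: prob_simplex_def)
  ultimately show ?thesis
    using assms by (intro affine_dim_equal) auto
qed

text \<open>Differences of points of \<open>C\<close> have coordinate sum zero, so replacing
  \<open>V\<close> and \<open>W\<close> by their projections changes neither maximizer; the
  projection itself is 1-Lipschitz.\<close>

lemma projected_maximizer_Lipschitz:
  fixes C :: "(real^'n) set"
  assumes C: "rel_strongly_convex R C" "R > 0" "C \<subseteq> prob_simplex" "aff_dim C = int CARD('n) - 1"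
    and r: "0 < r" "r \<le> norm (closest_point zero_sum_space V)" "r \<le> norm (closest_point zero_sum_space W)"
    and p: "p \<in> C" "\<forall>q\<in>C. V \<bullet> q \<le> V \<bullet> p"
    and q: "q \<in> C" "\<forall>p\<in>C. W \<bullet> p \<le> W \<bullet> q"
  shows "norm (p - q) \<le> R / r * norm (V - W)"
proof -
  have diff: "a - b \<in> zero_sum_space" if "a \<in> C" "b \<in> C" for a b
    using that C(3) by (auto simp: zero_sum_space_def prob_simplex_def sum_subtractf subset_iff)
  have proj: "closest_point zero_sum_space X \<bullet> a \<le> closest_point zero_sum_space X \<bullet> b"
    if "a \<in> C" "b \<in> C" "X \<bullet> a \<le> X \<bullet> b" for X a b
    using zero_sum_space_closest_point(2)[OF diff[OF that(1,2)], of X] that(3)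
    by (simp add: inner_diff_right)
  have hull: "affine hull C = {q. (\<Sum>i\<in>UNIV. q $ i) = 1}"
    using C p(1) by (intro affine_hull_full_simplex_subset) auto
  have "norm (p - q) \<le> R / r * norm (closest_point zero_sum_space V - closest_point zero_sum_space W)"
    using r p q by (intro maximizer_Lipschitz[OF C(1,2) hull] zero_sum_space_closest_point(1)) (auto intro: proj)
  also have "\<dots> \<le> R / r * norm (V - W)"
    using C(2) r(1) by (intro mult_left_mono zero_sum_space_closest_point(3)) auto
  finally show ?thesis .
qed

section \<open>Robust evaluation\<close>

context robust_mdp
begin

lemma kernel_inner_eq:
  fixes \<pi> :: "real^'a^'s"
  shows "(\<Sum>s'\<in>UNIV. state_kernel \<pi> P s s' * V $ s') = (\<Sum>a\<in>UNIV. \<pi> $ s $ a * (P $ s $ a \<bullet> V))"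
  unfolding state_kernel_def sum_distrib_right inner_vec_def
  by (subst sum.swap) (simp add: sum_distrib_left mult.assoc)

text \<open>Worst in the greedy sense: a single \<open>u\<close> maximizes the one-step expectation
  of \<open>V\<close> at all state-action pairs simultaneously. That such a \<open>u\<close> also
  attains the robust values when \<open>V\<close> is the robust value is
  \<open>robust_evaluation\<close>.\<close>

definition worst_perturbation :: "real^'s \<Rightarrow> real^'s^'a^'s \<Rightarrow> bool" where
  "worst_perturbation V u \<longleftrightarrow>
    u \<in> U \<and> (\<forall>s a. \<forall>u'\<in>U. (PN + u') $ s $ a \<bullet> V \<le> (PN + u) $ s $ a \<bullet> V)"

text \<open>Compactness gives a maximizer for each pair separately, and rectangularity allows their
  rows to be pasted into one element of \<open>U\<close>.\<close>

lemma worst_perturbation_exists: "\<exists>u. worst_perturbation V u"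
proof -
  have "\<exists>v\<in>U. \<forall>u'\<in>U. u' $ s $ a \<bullet> V \<le> v $ s $ a \<bullet> V" for s a
    by (intro continuous_attains_sup[OF compact nonempty] continuous_intros)
  then obtain f where f: "\<And>s a. f s a \<in> U" "\<And>s a u'. u' \<in> U \<Longrightarrow> u' $ s $ a \<bullet> V \<le> f s a $ s $ a \<bullet> V"
    by metis
  let ?u = "\<chi> s a. f s a $ s $ a"
  have "?u \<in> U"
    by (subst rectangular) (use f in \<open>auto simp: u_section_def\<close>)
  then show ?thesis
    using f by (auto simp: worst_perturbation_def inner_add_left intro!: exI[of _ ?u])
qed

lemma state_value_le_robust_V:
  assumes "\<pi> \<in> policies" "u \<in> U"
  shows "state_value c \<gamma> (PN + u) \<pi> s \<le> robust_V c \<gamma> PN U \<pi> $ s"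
proof -
  have "bdd_above ((\<lambda>u. state_value c \<gamma> (PN + u) \<pi> s) ` U)"
    using state_value_bounds(2)[OF assms(1) perturbed discount] cost_pos cost_le_1
    by (intro bdd_aboveI2[where M = "1 / (1 - \<gamma>)"]) (auto simp: less_imp_le)
  then show ?thesis
    using assms by (auto simp: robust_V_def intro: cSUP_upper)
qed

lemma robust_V_bounds:
  assumes "\<pi> \<in> policies"
  shows "0 \<le> robust_V c \<gamma> PN U \<pi> $ s" "robust_V c \<gamma> PN U \<pi> $ s \<le> 1 / (1 - \<gamma>)"
proof -
  obtain u where "u \<in> U" using nonempty by auto
  then show "0 \<le> robust_V c \<gamma> PN U \<pi> $ s"
    using state_value_bounds(1)[OF assms perturbed discount, of u c s] cost_pos cost_le_1
      state_value_le_robust_V[OF assms, of u s] by (auto simp: less_imp_le)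
  show "robust_V c \<gamma> PN U \<pi> $ s \<le> 1 / (1 - \<gamma>)"
    using state_value_bounds(2)[OF assms perturbed discount] cost_pos cost_le_1 nonempty
    by (auto simp: robust_V_def less_imp_le intro!: cSUP_least)
qed

text \<open>The robust value is bounded by its own one-step backup under the greedy kernel
  \<open>u\<close>, whereas the value under \<open>u\<close> satisfies this backup with equality.
  The maximum principle makes the two coincide, so one \<open>u\<close> attains the supremum at
  every state and, by one more step, for every action.\<close>

lemma robust_evaluation:
  assumes \<pi>: "\<pi> \<in> policies" and u: "worst_perturbation (robust_V c \<gamma> PN U \<pi>) u"
  shows "robust_V c \<gamma> PN U \<pi> $ s = state_value c \<gamma> (PN + u) \<pi> s"
    and "robust_Q c \<gamma> PN U \<pi> $ s $ a = c s a + \<gamma> * ((PN + u) $ s $ a \<bullet> robust_V c \<gamma> PN U \<pi>)"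
proof -
  let ?V = "robust_V c \<gamma> PN U \<pi>" and ?v = "\<lambda>u. state_value c \<gamma> (PN + u) \<pi>"
  have u0: "u \<in> U" and greedy: "u' \<in> U \<Longrightarrow> (PN + u') $ s $ a \<bullet> ?V \<le> (PN + u) $ s $ a \<bullet> ?V" for u' s a
    using u by (auto simp: worst_perturbation_def)
  \<comment> \<open>Two relaxations: the value under \<open>u'\<close> is at most the robust value,
    and \<open>u\<close> is greedy for the robust value.\<close>
  have step: "(\<Sum>s'\<in>UNIV. (PN + u') $ s $ a $ s' * ?v u' s') \<le> (PN + u) $ s $ a \<bullet> ?V" if u': "u' \<in> U" for u' s a
  proof -
    have "(\<Sum>s'\<in>UNIV. (PN + u') $ s $ a $ s' * ?v u' s') \<le> (PN + u') $ s $ a \<bullet> ?V"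
      unfolding inner_vec_def inner_real_def
      by (intro sum_mono mult_left_mono state_value_le_robust_V[OF \<pi> u'] kernel_nonneg[OF \<pi> perturbed[OF u'] discount])
    then show ?thesis using greedy[OF u', of s a] by simp
  qed
  have V_le: "?V $ s \<le> (\<Sum>a\<in>UNIV. \<pi> $ s $ a * c s a) + \<gamma> * (\<Sum>s'\<in>UNIV. state_kernel \<pi> (PN + u) s s' * ?V $ s')" for s
  proof -
    have "?v u' s \<le> (\<Sum>a\<in>UNIV. \<pi> $ s $ a * c s a) + \<gamma> * (\<Sum>s'\<in>UNIV. state_kernel \<pi> (PN + u) s s' * ?V $ s')"
      if u': "u' \<in> U" for u'
    proof -
      note P = \<pi> perturbed[OF u'] discount
      have "?v u' s = (\<Sum>a\<in>UNIV. \<pi> $ s $ a * (c s a + \<gamma> * (\<Sum>s'\<in>UNIV. (PN + u') $ s $ a $ s' * ?v u' s')))"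
        by (simp only: action_value_state_value(1)[OF P, of c s] action_value_state_value(2)[OF P, of c s])
      also have "\<dots> \<le> (\<Sum>a\<in>UNIV. \<pi> $ s $ a * (c s a + \<gamma> * ((PN + u) $ s $ a \<bullet> ?V)))"
        using discount by (intro sum_mono mult_left_mono add_left_mono step u' policy_nonneg[OF P]) auto
      also have "\<dots> = (\<Sum>a\<in>UNIV. \<pi> $ s $ a * c s a) + \<gamma> * (\<Sum>s'\<in>UNIV. state_kernel \<pi> (PN + u) s s' * ?V $ s')"
        unfolding kernel_inner_eq by (simp add: distrib_left sum.distrib sum_distrib_left mult.left_commute)
      finally show ?thesis .
    qed
    then show ?thesis
      using nonempty by (subst robust_V_def) (auto intro: cSUP_least)
  qed
  note P = \<pi> perturbed[OF u0] discount
  have eq: "?V $ s = ?v u s" for s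
  proof (rule antisym)
    have "?V $ s - ?v u s \<le> 0"
    proof (rule maximum_principle[OF P])
      show "?V $ s - ?v u s \<le> \<gamma> * (\<Sum>s'\<in>UNIV. state_kernel \<pi> (PN + u) s s' * (?V $ s' - ?v u s'))" for s
        using V_le[of s] state_value_Bellman[OF P, of c s]
        by (simp add: right_diff_distrib sum_subtractf)
    qed
    then show "?V $ s \<le> ?v u s" by simp
  qed (rule state_value_le_robust_V[OF \<pi> u0])
  show "?V $ s = ?v u s" by (rule eq)
  have q: "action_value c \<gamma> (PN + u') \<pi> s a \<le> c s a + \<gamma> * ((PN + u) $ s $ a \<bullet> ?V)" if u': "u' \<in> U" for u'
    using step[OF u', of s a] discount action_value_state_value(2)[OF \<pi> perturbed[OF u'] discount, of c s a]
    by simp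
  have q_u: "action_value c \<gamma> (PN + u) \<pi> s a = c s a + \<gamma> * ((PN + u) $ s $ a \<bullet> ?V)"
    using action_value_state_value(2)[OF P, of c s a] by (simp add: inner_vec_def eq)
  show "robust_Q c \<gamma> PN U \<pi> $ s $ a = c s a + \<gamma> * ((PN + u) $ s $ a \<bullet> ?V)"
  proof (rule antisym)
    show "robust_Q c \<gamma> PN U \<pi> $ s $ a \<le> c s a + \<gamma> * ((PN + u) $ s $ a \<bullet> ?V)"
      using q nonempty by (auto simp: robust_Q_def intro!: cSUP_least)
    have "action_value c \<gamma> (PN + u) \<pi> s a \<le> robust_Q c \<gamma> PN U \<pi> $ s $ a"
      using q u0 by (auto simp: robust_Q_def intro!: cSUP_upper bdd_aboveI2)
    then show "c s a + \<gamma> * ((PN + u) $ s $ a \<bullet> ?V) \<le> robust_Q c \<gamma> PN U \<pi> $ s $ a"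
      by (simp add: q_u)
  qed
qed

section \<open>Policy improvement and performance difference\<close>

lemma robust_Q_inner:
  assumes \<pi>: "\<pi> \<in> policies" and u: "worst_perturbation (robust_V c \<gamma> PN U \<pi>) u"
  shows "robust_Q c \<gamma> PN U \<pi> $ s \<bullet> \<pi>' $ s = (\<Sum>a\<in>UNIV. \<pi>' $ s $ a * c s a)
    + \<gamma> * (\<Sum>s'\<in>UNIV. state_kernel \<pi>' (PN + u) s s' * robust_V c \<gamma> PN U \<pi> $ s')"
  unfolding kernel_inner_eq inner_vec_def[of "robust_Q c \<gamma> PN U \<pi> $ s"] robust_evaluation(2)[OF assms]
  by (simp add: distrib_left distrib_right sum.distrib sum_distrib_left mult_ac)

lemma robust_V_eq_inner:
  assumes \<pi>: "\<pi> \<in> policies"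
  shows "robust_V c \<gamma> PN U \<pi> $ s = robust_Q c \<gamma> PN U \<pi> $ s \<bullet> \<pi> $ s"
proof -
  obtain u where u: "worst_perturbation (robust_V c \<gamma> PN U \<pi>) u"
    using worst_perturbation_exists by blast
  then have u0: "u \<in> U"
    by (simp add: worst_perturbation_def)
  show ?thesis
    using state_value_Bellman[OF \<pi> perturbed[OF u0] discount, of c s] robust_Q_inner[OF \<pi> u, of s \<pi>]
    by (simp add: robust_evaluation(1)[OF \<pi> u])
qed

text \<open>The kernel \<open>u'\<close> that is worst for \<open>\<pi>'\<close> can only lower the
  backup of the old value, as \<open>u\<close> is greedy for it. Hence the difference of the values
  is a subsolution, and the maximum principle gives monotonicity. Dropping the then nonpositive
  future term gives the second claim.\<close>

lemma robust_policy_improvement: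
  assumes \<pi>: "\<pi> \<in> policies" "\<pi>' \<in> policies"
    and improve: "\<And>s. robust_Q c \<gamma> PN U \<pi> $ s \<bullet> (\<pi>' $ s - \<pi> $ s) \<le> 0"
  shows "robust_V c \<gamma> PN U \<pi>' $ s \<le> robust_V c \<gamma> PN U \<pi> $ s"
    and "robust_Q c \<gamma> PN U \<pi> $ s \<bullet> (\<pi> $ s - \<pi>' $ s) \<le> robust_V c \<gamma> PN U \<pi> $ s - robust_V c \<gamma> PN U \<pi>' $ s"
proof -
  let ?V = "robust_V c \<gamma> PN U \<pi>" and ?V' = "robust_V c \<gamma> PN U \<pi>'" and ?Q = "robust_Q c \<gamma> PN U \<pi>"
  obtain u where u: "worst_perturbation ?V u"
    using worst_perturbation_exists by blast
  obtain u' where u': "worst_perturbation ?V' u'"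
    using worst_perturbation_exists by blast
  have u0: "u \<in> U" and greedy: "u' \<in> U \<Longrightarrow> (PN + u') $ s $ a \<bullet> ?V \<le> (PN + u) $ s $ a \<bullet> ?V" for u' s a
    using u by (auto simp: worst_perturbation_def)
  have u0': "u' \<in> U"
    using u' by (simp add: worst_perturbation_def)
  let ?K = "state_kernel \<pi>' (PN + u')"
  note P' = \<pi>(2) perturbed[OF u0'] discount
  have adv: "?V' $ s - ?V $ s \<le> ?Q $ s \<bullet> (\<pi>' $ s - \<pi> $ s) + \<gamma> * (\<Sum>s'\<in>UNIV. ?K s s' * (?V' $ s' - ?V $ s'))" for s
  proof -
    have "(\<Sum>s'\<in>UNIV. ?K s s' * ?V $ s') \<le> (\<Sum>s'\<in>UNIV. state_kernel \<pi>' (PN + u) s s' * ?V $ s')"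
      unfolding kernel_inner_eq by (intro sum_mono mult_left_mono greedy[OF u0'] policy_nonneg[OF P'])
    then have "\<gamma> * (\<Sum>s'\<in>UNIV. ?K s s' * ?V $ s') \<le> \<gamma> * (\<Sum>s'\<in>UNIV. state_kernel \<pi>' (PN + u) s s' * ?V $ s')"
      using discount by (intro mult_left_mono) auto
    moreover have "\<gamma> * (\<Sum>s'\<in>UNIV. ?K s s' * (?V' $ s' - ?V $ s')) =
      \<gamma> * (\<Sum>s'\<in>UNIV. ?K s s' * ?V' $ s') - \<gamma> * (\<Sum>s'\<in>UNIV. ?K s s' * ?V $ s')"
      by (simp add: right_diff_distrib sum_subtractf)
    ultimately show ?thesis
      using robust_Q_inner[OF \<pi>(1) u, of s \<pi>'] robust_Q_inner[OF \<pi>(2) u', of s \<pi>']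
        robust_V_eq_inner[OF \<pi>(1), of s] robust_V_eq_inner[OF \<pi>(2), of s]
      by (simp add: inner_diff_right)
  qed
  have mono: "?V' $ s - ?V $ s \<le> 0" for s
    by (rule maximum_principle[OF P', of "\<lambda>s. ?V' $ s - ?V $ s"]) (use adv improve in \<open>smt (verit)\<close>)
  then show "?V' $ s \<le> ?V $ s" by simp
  have "(\<Sum>s'\<in>UNIV. ?K s s' * (?V' $ s' - ?V $ s')) \<le> 0"
    by (intro sum_nonpos mult_nonneg_nonpos mono state_kernel_nonneg[OF P'])
  then have "\<gamma> * (\<Sum>s'\<in>UNIV. ?K s s' * (?V' $ s' - ?V $ s')) \<le> 0"
    using discount by (intro mult_nonneg_nonpos) auto
  then show "?Q $ s \<bullet> (\<pi> $ s - \<pi>' $ s) \<le> ?V $ s - ?V' $ s"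
    using adv[of s] by (simp add: inner_diff_right)
qed

text \<open>Lowering the robust value of \<open>\<pi>'\<close> to its value under \<open>u\<close>
  fixes one kernel for both policies; under it the classical performance difference identity holds,
  through the resolvent. Only this first replacement costs an inequality.\<close>

lemma robust_performance_difference:
  assumes \<pi>: "\<pi> \<in> policies" "\<pi>' \<in> policies" and \<rho>: "\<rho> \<in> prob_simplex" and u: "worst_perturbation (robust_V c \<gamma> PN U \<pi>) u"
  shows "(1 - \<gamma>) * (objective c \<gamma> PN U \<rho> \<pi> - objective c \<gamma> PN U \<rho> \<pi>') \<le>
    (\<Sum>s\<in>UNIV. visitation_from \<gamma> (PN + u) \<pi>' \<rho> s * (robust_Q c \<gamma> PN U \<pi> $ s \<bullet> (\<pi> $ s - \<pi>' $ s)))"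
proof -
  let ?V = "robust_V c \<gamma> PN U \<pi>" and ?v = "state_value c \<gamma> (PN + u) \<pi>'" and ?Q = "robust_Q c \<gamma> PN U \<pi>"
  have u0: "u \<in> U"
    using u by (simp add: worst_perturbation_def)
  note P = \<pi>(2) perturbed[OF u0] discount
  have "(1 - \<gamma>) * (objective c \<gamma> PN U \<rho> \<pi> - objective c \<gamma> PN U \<rho> \<pi>') \<le> (1 - \<gamma>) * (\<Sum>s\<in>UNIV. \<rho> $ s * (?V $ s - ?v s))"
    unfolding objective_def sum_subtractf[symmetric] right_diff_distrib[symmetric]
    using discount \<rho> state_value_le_robust_V[OF \<pi>(2) u0]
    by (intro mult_left_mono sum_mono) (auto simp: prob_simplex_def)
  also have "\<dots> = (\<Sum>s\<in>UNIV. visitation_from \<gamma> (PN + u) \<pi>' \<rho> s *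
    (?V $ s - ?v s - \<gamma> * (\<Sum>s'\<in>UNIV. state_kernel \<pi>' (PN + u) s s' * (?V $ s' - ?v s'))))"
    by (rule visitation_from_resolvent[OF P, symmetric])
  also have "\<dots> = (\<Sum>s\<in>UNIV. visitation_from \<gamma> (PN + u) \<pi>' \<rho> s * (?Q $ s \<bullet> (\<pi> $ s - \<pi>' $ s)))"
  proof (intro sum.cong refl arg_cong2[where f = "(*)"])
    fix s
    have "\<gamma> * (\<Sum>s'\<in>UNIV. state_kernel \<pi>' (PN + u) s s' * (?V $ s' - ?v s')) =
      \<gamma> * (\<Sum>s'\<in>UNIV. state_kernel \<pi>' (PN + u) s s' * ?V $ s') - \<gamma> * (\<Sum>s'\<in>UNIV. state_kernel \<pi>' (PN + u) s s' * ?v s')"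
      by (simp add: right_diff_distrib sum_subtractf)
    then show "?V $ s - ?v s - \<gamma> * (\<Sum>s'\<in>UNIV. state_kernel \<pi>' (PN + u) s s' * (?V $ s' - ?v s')) = ?Q $ s \<bullet> (\<pi> $ s - \<pi>' $ s)"
      using robust_Q_inner[OF \<pi>(1) u, of s \<pi>'] robust_V_eq_inner[OF \<pi>(1), of s]
        state_value_Bellman[OF P, of c s]
      by (simp add: inner_diff_right)
  qed
  finally show ?thesis .
qed

end

section \<open>Stability of the worst kernel and distribution mismatch\<close>

lemma (in robust_mdp) ambiguity_set_subset_prob_simplex: "ambiguity_set PN U s a \<subseteq> prob_simplex"
  using perturbed by (auto simp: ambiguity_set_def u_section_def kernels_def)

text \<open>Each row of a worst kernel maximizes the linear functional given by \<open>V\<close>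
  over the ambiguity set of that pair, so the Lipschitz estimate for maximizers applies row by
  row.\<close>

lemma (in robust_mdp) worst_kernel_Lipschitz:
  assumes R: "R > 0" "rel_strongly_convex R (ambiguity_set PN U s a)"
    and dim: "aff_dim (ambiguity_set PN U s a) = int CARD('s) - 1"
    and r: "0 < r" "r \<le> norm (closest_point zero_sum_space V)" "r \<le> norm (closest_point zero_sum_space V')"
    and u: "worst_perturbation V u" "worst_perturbation V' u'"
  shows "norm ((PN + u) $ s $ a - (PN + u') $ s $ a) \<le> R / r * norm (V - V')"
proof (rule projected_maximizer_Lipschitz[OF R(2,1) ambiguity_set_subset_prob_simplex dim r])
  have mem: "(PN + v) $ s $ a \<in> ambiguity_set PN U s a" if "v \<in> U" for v
    using that by (auto simp: ambiguity_set_def u_section_def)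
  have max: "\<forall>q\<in>ambiguity_set PN U s a. W \<bullet> q \<le> W \<bullet> (PN + v) $ s $ a" if "worst_perturbation W v" for W v
    using that by (auto simp: ambiguity_set_def u_section_def worst_perturbation_def inner_commute)
  show "(PN + u) $ s $ a \<in> ambiguity_set PN U s a" "(PN + u') $ s $ a \<in> ambiguity_set PN U s a"
    using u mem by (auto simp: worst_perturbation_def)
  show "\<forall>q\<in>ambiguity_set PN U s a. V \<bullet> q \<le> V \<bullet> (PN + u) $ s $ a"
    "\<forall>q\<in>ambiguity_set PN U s a. V' \<bullet> q \<le> V' \<bullet> (PN + u') $ s $ a"
    using u max by auto
qed

lemma r_min_le:
  assumes "\<pi> \<in> policies"
  shows "r_min c \<gamma> PN U \<le> norm (closest_point zero_sum_space (robust_V c \<gamma> PN U \<pi>))"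
  unfolding r_min_def using assms by (intro cINF_lower bdd_belowI2[where m = 0]) auto

text \<open>The delicate case is \<open>\<rho> $ s = 0\<close>: a positive visitation there would
  make the quotient in \<open>ennreal\<close> infinite, against the finiteness of the
  mismatch.\<close>

lemma visitation_le_mismatch:
  assumes "mismatch \<gamma> PN U \<pi> \<rho> < \<infinity>" and "u \<in> U" and \<rho>: "0 \<le> \<rho> $ s"
  shows "visitation_from \<gamma> (PN + u) \<pi> \<rho> s \<le> enn2real (mismatch \<gamma> PN U \<pi> \<rho>) * \<rho> $ s"
proof -
  let ?m = "mismatch \<gamma> PN U \<pi> \<rho>" and ?d = "visitation_from \<gamma> (PN + u) \<pi> \<rho> s"
  have le: "ennreal ?d / ennreal (\<rho> $ s) \<le> ?m"
    unfolding mismatch_def using \<open>u \<in> U\<close> by (intro SUP_upper2[of u] SUP_upper) auto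
  have m: "?m = ennreal (enn2real ?m)"
    using assms(1) by (simp add: less_top)
  show ?thesis
  proof (cases "\<rho> $ s = 0")
    case True
    have "ennreal ?d = 0"
    proof (rule ccontr)
      assume "ennreal ?d \<noteq> 0"
      then have "ennreal ?d / ennreal (\<rho> $ s) = top"
        by (simp add: True ennreal_divide_zero)
      with le assms(1) show False by (simp add: top_unique)
    qed
    then show ?thesis
      using True by (simp add: ennreal_eq_0_iff)
  next
    case False
    then have pos: "0 < \<rho> $ s" using \<rho> by simp
    show ?thesis
    proof (cases "0 \<le> ?d")
      case True
      then have "ennreal (?d / \<rho> $ s) \<le> ennreal (enn2real ?m)"
        using le m pos by (simp add: divide_ennreal)
      then have "?d / \<rho> $ s \<le> enn2real ?m"
        by (simp add: ennreal_le_iff)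
      then show ?thesis using pos by (simp add: pos_divide_le_eq)
    next
      \<comment> \<open>\<open>ennreal\<close> sends negative numbers to 0, so the bound on the
        quotient is uninformative here, but the right-hand side is nonnegative.\<close>
      case False
      moreover have "0 \<le> enn2real ?m * \<rho> $ s" using pos by simp
      ultimately show ?thesis by linarith
    qed
  qed
qed

section \<open>Mirror descent\<close>

text \<open>All values of \<open>w\<close> cancel. The selections \<open>g\<close> and
  \<open>g'\<close> are kept separate because the subgradients may change between
  iterations.\<close>

lemma bregman_three_point:
  "bregman w g p x - bregman w g' p y - bregman w g y x = (g' y - g x) \<bullet> (p - y)"
  by (simp add: bregman_def inner_diff_left inner_diff_right)

lemma bregman_nonneg: "g q \<in> subdifferential w q \<Longrightarrow> 0 \<le> bregman w g p q"
  unfolding bregman_def subdifferential_def by (auto simp: algebra_simps dest: spec[of _ p])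

lemma norm_prob_simplex_le_1: "p \<in> prob_simplex \<Longrightarrow> norm p \<le> 1"
  using norm_le_norm1[of p] by (auto simp: norm1_def prob_simplex_def)

text \<open>Jensen's inequality, as \<open>p\<close> is a convex combination of the unit
  vectors.\<close>

lemma convex_function_le_on_prob_simplex:
  fixes w :: "real^'n \<Rightarrow> real"
  assumes w: "strictly_convex w" and p: "p \<in> prob_simplex"
  shows "w p \<le> (\<Sum>i\<in>UNIV. \<bar>w (axis i 1)\<bar>)"
proof -
  have cvx: "convex_on UNIV w"
  proof (rule convex_onI)
    show "w ((1 - t) *\<^sub>R x + t *\<^sub>R y) \<le> (1 - t) * w x + t * w y" if "0 < t" "t < 1" for t x y
      using w that by (cases "x = y")
        (auto simp: strictly_convex_def scaleR_left_distrib[symmetric] algebra_simps less_imp_le)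
  qed simp
  have le1: "p $ i \<le> 1" for i
    using p component_le_norm_cart[of p i] norm_prob_simplex_le_1[OF p] by simp
  have "w p = w (\<Sum>i\<in>UNIV. p $ i *\<^sub>R axis i 1)"
    using basis_expansion[of p] by (simp add: scalar_mult_eq_scaleR)
  also have "\<dots> \<le> (\<Sum>i\<in>UNIV. p $ i * w (axis i 1))"
    using p by (intro convex_on_sum[OF _ _ cvx]) (auto simp: prob_simplex_def)
  also have "\<dots> \<le> (\<Sum>i\<in>UNIV. \<bar>w (axis i 1)\<bar>)"
  proof (rule sum_mono)
    fix i
    have "p $ i * w (axis i 1) \<le> p $ i * \<bar>w (axis i 1)\<bar>"
      using p by (intro mult_left_mono) (auto simp: prob_simplex_def)
    also have "\<dots> \<le> \<bar>w (axis i 1)\<bar>"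
      using le1 p by (intro mult_left_le_one_le) (auto simp: prob_simplex_def)
    finally show "p $ i * w (axis i 1) \<le> \<bar>w (axis i 1)\<bar>" .
  qed
  finally show ?thesis .
qed

text \<open>Ensures that the supremum defining \<open>D_w\<close> is a genuine one. The value of
  \<open>w\<close> is bounded through the vertices and the linear term by Cauchy-Schwarz; summing
  the bounds over the finitely many states makes them uniform.\<close>

lemma bdd_above_bregman:
  fixes w :: "real^'a \<Rightarrow> real" and \<pi>\<^sub>0 :: "real^'a^'s::finite"
  assumes w: "strictly_convex w"
  shows "bdd_above ((\<lambda>(\<pi>', s). bregman w (g s) (\<pi>' $ s) (\<pi>\<^sub>0 $ s)) ` (policies \<times> UNIV))"
proof (rule bdd_aboveI2, clarify)
  fix \<pi>' :: "real^'a^'s" and s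
  assume "\<pi>' \<in> policies"
  then have p: "\<pi>' $ s \<in> prob_simplex"
    by (simp add: policies_def)
  let ?q = "\<pi>\<^sub>0 $ s"
  let ?b = "\<lambda>s. (\<Sum>i\<in>UNIV. \<bar>w (axis i 1)\<bar>) + \<bar>w (\<pi>\<^sub>0 $ s)\<bar> + norm (g s (\<pi>\<^sub>0 $ s)) * (1 + norm (\<pi>\<^sub>0 $ s))"
  have "\<bar>g s ?q \<bullet> (\<pi>' $ s - ?q)\<bar> \<le> norm (g s ?q) * norm (\<pi>' $ s - ?q)"
    by (rule Cauchy_Schwarz_ineq2)
  also have "\<dots> \<le> norm (g s ?q) * (1 + norm ?q)"
    using norm_triangle_ineq4[of "\<pi>' $ s" ?q] norm_prob_simplex_le_1[OF p] by (intro mult_left_mono) auto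
  finally have "bregman w (g s) (\<pi>' $ s) ?q \<le> ?b s"
    using convex_function_le_on_prob_simplex[OF w p] by (simp add: bregman_def)
  also have "\<dots> \<le> (\<Sum>s\<in>UNIV. ?b s)"
    by (rule member_le_sum) (auto intro!: add_nonneg_nonneg sum_nonneg mult_nonneg_nonneg)
  finally show "bregman w (g s) (\<pi>' $ s) ?q \<le> (\<Sum>s\<in>UNIV. ?b s)" .
qed

text \<open>One of two distinct actions has probability at most one half, and the vertex at
  \<open>i\<close> has 1-norm distance \<open>2 * (1 - p $ i)\<close> from \<open>p\<close>. Strong
  convexity turns this into a lower bound on \<open>D_w\<close>.\<close>

lemma vertex_far_from_policy:
  fixes p :: "real^'a"
  assumes p: "p \<in> prob_simplex" and "a \<noteq> (b :: 'a)"
  obtains i where "1 \<le> norm1 (axis i 1 - p)"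
proof -
  have "p $ a + p $ b \<le> 1"
    using p sum_mono2[of UNIV "{a, b}" "\<lambda>i. p $ i"] \<open>a \<noteq> b\<close> by (auto simp: prob_simplex_def)
  then obtain i where i: "p $ i \<le> 1 / 2"
    by (metis add_mono_thms_linordered_field(5) field_sum_of_halves not_le)
  have "(\<Sum>j\<in>UNIV - {i}. p $ j) = 1 - p $ i"
    using p sum.remove[of UNIV i "\<lambda>j. p $ j"] by (simp add: prob_simplex_def)
  moreover have "norm1 (axis i 1 - p) = \<bar>1 - p $ i\<bar> + (\<Sum>j\<in>UNIV - {i}. \<bar>axis i 1 $ j - p $ j\<bar>)"
    unfolding norm1_def by (subst sum.remove[of _ i]) (auto simp: axis_def)
  moreover have "(\<Sum>j\<in>UNIV - {i}. \<bar>axis i 1 $ j - p $ j\<bar>) = (\<Sum>j\<in>UNIV - {i}. p $ j)"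
    using p by (intro sum.cong) (auto simp: axis_def prob_simplex_def)
  ultimately have "1 \<le> norm1 (axis i 1 - p)"
    using i by simp
  then show ?thesis by (rule that)
qed

lemma summation_by_parts_bound:
  fixes d D :: "nat \<Rightarrow> real"
  assumes d: "\<And>j. 0 \<le> d j" and D: "\<And>j. 0 \<le> D j" "\<And>j. D j \<le> B"
  shows "(\<Sum>j<Suc n. d j * (D j - D (Suc j))) \<le> d 0 * D 0 + B * (\<Sum>j<n. \<bar>d (Suc j) - d j\<bar>)"
proof -
  \<comment> \<open>The boundary term is kept on the left so that the induction closes; being
    nonnegative, it is dropped at the end.\<close>
  have "(\<Sum>j<Suc n. d j * (D j - D (Suc j))) + d n * D (Suc n) \<le> d 0 * D 0 + B * (\<Sum>j<n. \<bar>d (Suc j) - d j\<bar>)"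
  proof (induction n)
    case (Suc n)
    have "(d (Suc n) - d n) * D (Suc n) \<le> \<bar>d (Suc n) - d n\<bar> * B"
      using D by (intro mult_mono) auto
    then show ?case
      using Suc by (simp add: algebra_simps)
  qed (simp add: algebra_simps)
  moreover have "0 \<le> d n * D (Suc n)"
    using d D by simp
  ultimately show ?thesis by linarith
qed

section \<open>The iterates of robust policy mirror descent\<close>

locale robust_mirror_descent = robust_mdp c \<gamma> PN U
  for c :: "'s::finite \<Rightarrow> 'a::finite \<Rightarrow> real" and \<gamma> PN U +
  fixes \<eta> :: real and w :: "real^'a \<Rightarrow> real" and G :: "nat \<Rightarrow> 's \<Rightarrow> real^'a \<Rightarrow> real^'a"
    and \<pi> :: "nat \<Rightarrow> real^'a^'s"
  assumes eta_pos: "0 < \<eta>"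
    and subgradients: "\<And>j s p. p \<in> prob_simplex \<Longrightarrow> G j s p \<in> subdifferential w p"
    and algorithm: "rpmd c \<gamma> PN U w G (\<lambda>j. \<eta>) \<pi>"
begin

abbreviation "V j \<equiv> robust_V c \<gamma> PN U (\<pi> j)"
abbreviation "Q j \<equiv> robust_Q c \<gamma> PN U (\<pi> j)"
abbreviation "f \<rho> \<pi>' \<equiv> objective c \<gamma> PN U \<rho> \<pi>'"

lemma iterate_in_prob_simplex: "\<pi> j $ s \<in> prob_simplex"
  using algorithm by (cases j) (auto simp: rpmd_def policies_def is_arg_min_def)

lemma iterate_policy: "\<pi> j \<in> policies"
  by (simp add: policies_def iterate_in_prob_simplex)

lemma bregman_iterate_nonneg: "0 \<le> bregman w (G i s') p (\<pi> j $ s)"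
  using subgradients[OF iterate_in_prob_simplex] by (rule bregman_nonneg)

text \<open>The first-order optimality condition combined with the three-point identity; the
  divergence between consecutive iterates is nonnegative and is discarded.\<close>

lemma mirror_step:
  assumes "p \<in> prob_simplex"
  shows "\<eta> * (Q j $ s \<bullet> (\<pi> (Suc j) $ s - p)) \<le>
    bregman w (G j s) p (\<pi> j $ s) - bregman w (G (Suc j) s) p (\<pi> (Suc j) $ s)"
proof -
  have "0 \<le> (\<eta> *\<^sub>R Q j $ s + G (Suc j) s (\<pi> (Suc j) $ s) - G j s (\<pi> j $ s)) \<bullet> (p - \<pi> (Suc j) $ s)"
    using algorithm assms by (simp add: rpmd_def)
  then have "\<eta> * (Q j $ s \<bullet> (\<pi> (Suc j) $ s - p)) \<le> (G (Suc j) s (\<pi> (Suc j) $ s) - G j s (\<pi> j $ s)) \<bullet> (p - \<pi> (Suc j) $ s)"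
    by (simp add: inner_diff_right inner_diff_left inner_add_left algebra_simps)
  also have "\<dots> = bregman w (G j s) p (\<pi> j $ s) - bregman w (G (Suc j) s) p (\<pi> (Suc j) $ s)
    - bregman w (G j s) (\<pi> (Suc j) $ s) (\<pi> j $ s)"
    by (rule bregman_three_point[symmetric])
  also have "\<dots> \<le> bregman w (G j s) p (\<pi> j $ s) - bregman w (G (Suc j) s) p (\<pi> (Suc j) $ s)"
    using bregman_iterate_nonneg by simp
  finally show ?thesis .
qed

text \<open>\<open>mirror_step\<close> with the current iterate as comparison point, whose
  divergence from itself vanishes.\<close>

lemma iterate_improves: "Q j $ s \<bullet> (\<pi> (Suc j) $ s - \<pi> j $ s) \<le> 0"
proof -
  have "\<eta> * (Q j $ s \<bullet> (\<pi> (Suc j) $ s - \<pi> j $ s)) \<le> 0"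
    using mirror_step[OF iterate_in_prob_simplex[of j s], of j s]
      bregman_iterate_nonneg[of "Suc j" s "\<pi> j $ s" "Suc j" s]
    by (simp add: bregman_def)
  then show ?thesis
    using eta_pos by (simp add: mult_le_0_iff)
qed

lemma V_decreasing: "V (Suc j) $ s \<le> V j $ s"
  and advantage_le_V_diff: "Q j $ s \<bullet> (\<pi> j $ s - \<pi> (Suc j) $ s) \<le> V j $ s - V (Suc j) $ s"
  using robust_policy_improvement[OF iterate_policy iterate_policy, of j "Suc j" s] iterate_improves by auto

lemma objective_decreasing:
  assumes "\<rho> \<in> prob_simplex" "i \<le> j"
  shows "f \<rho> (\<pi> j) \<le> f \<rho> (\<pi> i)"
proof (rule lift_Suc_antimono_le[of "\<lambda>j. f \<rho> (\<pi> j)", OF _ assms(2)])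
  show "f \<rho> (\<pi> (Suc j)) \<le> f \<rho> (\<pi> j)" for j
    using assms(1) V_decreasing unfolding objective_def prob_simplex_def
    by (auto intro!: sum_mono mult_left_mono)
qed

text \<open>The estimates below hold for whichever worst perturbation is chosen.\<close>

definition worst_u :: "nat \<Rightarrow> real^'s^'a^'s" where
  "worst_u j = (SOME u. worst_perturbation (V j) u)"

lemma worst_perturbation_worst_u: "worst_perturbation (V j) (worst_u j)"
  unfolding worst_u_def by (rule someI_ex[OF worst_perturbation_exists])

lemma worst_u_in_U: "worst_u j \<in> U"
  using worst_perturbation_worst_u[of j] by (simp add: worst_perturbation_def)

text \<open>The value sequence has finite length: every coordinate decreases monotonically inside an
  interval of length \<open>1 / (1 - \<gamma>)\<close>, so the 1-norms of the increments
  telescope.\<close>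

lemma sum_norm_V_diff: "(\<Sum>j<n. norm (V (Suc j) - V j)) \<le> real CARD('s) / (1 - \<gamma>)"
proof -
  have "(\<Sum>j<n. norm (V (Suc j) - V j)) \<le> (\<Sum>j<n. \<Sum>s\<in>UNIV. V j $ s - V (Suc j) $ s)"
  proof (rule sum_mono)
    show "norm (V (Suc j) - V j) \<le> (\<Sum>s\<in>UNIV. V j $ s - V (Suc j) $ s)" for j
      using norm_le_norm1[of "V (Suc j) - V j"] V_decreasing[of j] by (simp add: norm1_def)
  qed
  also have "\<dots> = (\<Sum>s\<in>UNIV. V 0 $ s - V n $ s)"
    by (subst sum.swap) (simp add: sum_lessThan_telescope'[of "\<lambda>j. V j $ _"])
  also have "\<dots> \<le> (\<Sum>s\<in>(UNIV :: 's set). 1 / (1 - \<gamma>))"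
    using robust_V_bounds(2)[OF iterate_policy, of 0] robust_V_bounds(1)[OF iterate_policy, of n]
    by (intro sum_mono) (smt (verit))
  finally show ?thesis by simp
qed

section \<open>Error estimate in terms of bounds on the constants of the theorem\<close>

context
  fixes \<pi>_star :: "real^'a^'s" and \<rho> :: "real^'s" and M R r D_w D_w_star :: real
  assumes \<pi>_star: "\<pi>_star \<in> policies" and \<rho>: "\<rho> \<in> prob_simplex"
    and optimal: "\<And>\<pi>'. \<pi>' \<in> policies \<Longrightarrow> f \<rho> \<pi>_star \<le> f \<rho> \<pi>'"
    and M: "0 \<le> M" "\<And>u s. u \<in> U \<Longrightarrow> visitation_from \<gamma> (PN + u) \<pi>_star \<rho> s \<le> M * \<rho> $ s"
    and D_w: "\<And>s. bregman w (G 0 s) (\<pi>_star $ s) (\<pi> 0 $ s) \<le> D_w"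
    and D_w_star: "\<And>j s. bregman w (G j s) (\<pi>_star $ s) (\<pi> j $ s) \<le> D_w_star"
    and R: "\<And>s a. \<exists>R'>0. R' \<le> R \<and> rel_strongly_convex R' (ambiguity_set PN U s a)"
    and dim: "\<And>s a. aff_dim (ambiguity_set PN U s a) = int CARD('s) - 1"
    and r: "0 < r" "\<And>j. r \<le> norm (closest_point zero_sum_space (V j))"
begin

abbreviation "d j \<equiv> visitation_from \<gamma> (PN + worst_u j) \<pi>_star \<rho>"
abbreviation "D j s \<equiv> bregman w (G j s) (\<pi>_star $ s) (\<pi> j $ s)"

text \<open>The worst kernel is Lipschitz in the value, and the visitation measure is Lipschitz in
  the kernel with factor \<open>\<gamma> / (1 - \<gamma>)\<close>. The factor
  \<open>real CARD('s)\<close> is the price of passing from the Euclidean norm to the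
  1-norm.\<close>

lemma visitation_step:
  "(\<Sum>s\<in>UNIV. \<bar>d (Suc j) s - d j s\<bar>) \<le> \<gamma> * real CARD('s) * R / ((1 - \<gamma>) * r) * norm (V (Suc j) - V j)"
proof -
  have "norm1 ((PN + worst_u (Suc j)) $ s $ a - (PN + worst_u j) $ s $ a) \<le> real CARD('s) * (R / r * norm (V (Suc j) - V j))" for s a
  proof -
    obtain R' where R': "R' > 0" "R' \<le> R" "rel_strongly_convex R' (ambiguity_set PN U s a)"
      using R by blast
    have "norm ((PN + worst_u (Suc j)) $ s $ a - (PN + worst_u j) $ s $ a) \<le> R' / r * norm (V (Suc j) - V j)"
      by (intro worst_kernel_Lipschitz[OF R'(1,3) dim] r worst_perturbation_worst_u)
    also have "\<dots> \<le> R / r * norm (V (Suc j) - V j)"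
      using R' r by (intro mult_right_mono divide_right_mono) auto
    finally show ?thesis
      by (intro order_trans[OF norm1_le_norm] mult_left_mono) auto
  qed
  from visitation_from_kernel_perturbation[OF \<pi>_star perturbed perturbed discount \<rho> this, OF worst_u_in_U worst_u_in_U]
  show ?thesis by (simp add: mult_ac)
qed

text \<open>The step from \<open>\<pi> j\<close> to \<open>\<pi>_star\<close> is split at
  \<open>\<pi> (Suc j)\<close>: the first part is bounded by the decrease of the value, the second
  by the mirror step.\<close>

lemma iteration_bound:
  "(1 - \<gamma>) * (f \<rho> (\<pi> j) - f \<rho> \<pi>_star) \<le> M * (f \<rho> (\<pi> j) - f \<rho> (\<pi> (Suc j)))
    + (\<Sum>s\<in>UNIV. d j s * (D j s - D (Suc j) s)) / \<eta>"
proof -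
  note P = \<pi>_star perturbed[OF worst_u_in_U] discount
  have "Q j $ s \<bullet> (\<pi> j $ s - \<pi>_star $ s) \<le> (V j $ s - V (Suc j) $ s) + (D j s - D (Suc j) s) / \<eta>" for s
  proof -
    have "Q j $ s \<bullet> (\<pi> (Suc j) $ s - \<pi>_star $ s) \<le> (D j s - D (Suc j) s) / \<eta>"
      using mirror_step[of "\<pi>_star $ s" j s] \<pi>_star eta_pos
      by (simp add: policies_def pos_le_divide_eq mult.commute)
    then show ?thesis
      using advantage_le_V_diff[of j s] by (simp add: inner_diff_right)
  qed
  then have "(\<Sum>s\<in>UNIV. d j s * (Q j $ s \<bullet> (\<pi> j $ s - \<pi>_star $ s))) \<le>
    (\<Sum>s\<in>UNIV. d j s * ((V j $ s - V (Suc j) $ s) + (D j s - D (Suc j) s) / \<eta>))"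
    by (intro sum_mono mult_left_mono visitation_from_distribution[OF P \<rho>])
  also have "\<dots> = (\<Sum>s\<in>UNIV. d j s * (V j $ s - V (Suc j) $ s)) + (\<Sum>s\<in>UNIV. d j s * (D j s - D (Suc j) s)) / \<eta>"
    by (simp only: distrib_left sum.distrib sum_divide_distrib times_divide_eq_right)
  \<comment> \<open>As the decrease is nonnegative, the weights \<open>d j\<close> may be enlarged
    to \<open>M\<close> times \<open>\<rho>\<close>, which no longer depends on \<open>j\<close> and
    so telescopes.\<close>
  also have "(\<Sum>s\<in>UNIV. d j s * (V j $ s - V (Suc j) $ s)) \<le> (\<Sum>s\<in>UNIV. M * \<rho> $ s * (V j $ s - V (Suc j) $ s))"
    using V_decreasing[of j] by (intro sum_mono mult_right_mono M(2) worst_u_in_U) auto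
  also have "\<dots> = M * (f \<rho> (\<pi> j) - f \<rho> (\<pi> (Suc j)))"
    by (simp add: objective_def sum_subtractf[symmetric] sum_distrib_left right_diff_distrib mult.assoc)
  finally show ?thesis
    using robust_performance_difference[OF iterate_policy \<pi>_star \<rho> worst_perturbation_worst_u, of j] by linarith
qed

lemma mirror_descent_bound:
  "(1 - \<gamma>) * real (Suc n) * (f \<rho> (\<pi> (Suc n)) - f \<rho> \<pi>_star) \<le> M * (f \<rho> (\<pi> 0) - f \<rho> \<pi>_star)
    + (D_w + D_w_star * (\<gamma> * (real CARD('s))\<^sup>2 * R / ((1 - \<gamma>)\<^sup>2 * r))) / \<eta>"
proof -
  note P = \<pi>_star perturbed[OF worst_u_in_U] discount
  have star: "0 \<le> D_w_star"
    \<comment> \<open>\<open>undefined\<close> serves as an arbitrary state.\<close>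
    using bregman_iterate_nonneg[of 0 undefined "\<pi>_star $ undefined" 0 undefined] D_w_star[of 0 undefined] by linarith
  have "0 \<le> R"
    using R[of undefined undefined] by auto
  have "(1 - \<gamma>) * real (Suc n) * (f \<rho> (\<pi> (Suc n)) - f \<rho> \<pi>_star) = (\<Sum>j<Suc n. (1 - \<gamma>) * (f \<rho> (\<pi> (Suc n)) - f \<rho> \<pi>_star))"
    by simp
  also have "\<dots> \<le> (\<Sum>j<Suc n. M * (f \<rho> (\<pi> j) - f \<rho> (\<pi> (Suc j))) + (\<Sum>s\<in>UNIV. d j s * (D j s - D (Suc j) s)) / \<eta>)"
  proof (rule sum_mono)
    fix j assume "j \<in> {..<Suc n}"
    \<comment> \<open>By monotonicity the last iterate is the best one, so its gap is at most the
      average gap.\<close>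
    then have "(1 - \<gamma>) * (f \<rho> (\<pi> (Suc n)) - f \<rho> \<pi>_star) \<le> (1 - \<gamma>) * (f \<rho> (\<pi> j) - f \<rho> \<pi>_star)"
      using discount objective_decreasing[OF \<rho>, of j "Suc n"] by (intro mult_left_mono) auto
    with iteration_bound[of j]
    show "(1 - \<gamma>) * (f \<rho> (\<pi> (Suc n)) - f \<rho> \<pi>_star) \<le>
      M * (f \<rho> (\<pi> j) - f \<rho> (\<pi> (Suc j))) + (\<Sum>s\<in>UNIV. d j s * (D j s - D (Suc j) s)) / \<eta>"
      by linarith
  qed
  also have "\<dots> = M * (f \<rho> (\<pi> 0) - f \<rho> (\<pi> (Suc n))) + (\<Sum>s\<in>UNIV. \<Sum>j<Suc n. d j s * (D j s - D (Suc j) s)) / \<eta>"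
    unfolding sum.distrib sum_distrib_left[symmetric] sum_divide_distrib[symmetric]
    by (subst sum.swap) (simp only: sum_lessThan_telescope'[of "\<lambda>j. f \<rho> (\<pi> j)"])
  also have "\<dots> \<le> M * (f \<rho> (\<pi> 0) - f \<rho> \<pi>_star) + (D_w + D_w_star * (\<gamma> * (real CARD('s))\<^sup>2 * R / ((1 - \<gamma>)\<^sup>2 * r))) / \<eta>"
  proof (intro add_mono mult_left_mono divide_right_mono)
    have "(\<Sum>s\<in>UNIV. \<Sum>j<Suc n. d j s * (D j s - D (Suc j) s))
      \<le> (\<Sum>s\<in>UNIV. d 0 s * D_w + D_w_star * (\<Sum>j<n. \<bar>d (Suc j) s - d j s\<bar>))"
    proof (rule sum_mono)
      fix s
      \<comment> \<open>Summation by parts, state by state, moves the differences from the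
        divergences to the changing weights.\<close>
      have "(\<Sum>j<Suc n. d j s * (D j s - D (Suc j) s)) \<le> d 0 s * D 0 s + D_w_star * (\<Sum>j<n. \<bar>d (Suc j) s - d j s\<bar>)"
        by (rule summation_by_parts_bound[of "\<lambda>j. d j s" "\<lambda>j. D j s"])
          (rule visitation_from_distribution[OF P \<rho>] bregman_iterate_nonneg D_w_star)+
      also have "d 0 s * D 0 s \<le> d 0 s * D_w"
        by (intro mult_left_mono D_w visitation_from_distribution[OF P \<rho>])
      finally show "(\<Sum>j<Suc n. d j s * (D j s - D (Suc j) s)) \<le> d 0 s * D_w + D_w_star * (\<Sum>j<n. \<bar>d (Suc j) s - d j s\<bar>)"
        by simp
    qed
    \<comment> \<open>\<open>d 0\<close> has total mass one.\<close>
    also have "\<dots> = D_w + D_w_star * (\<Sum>j<n. \<Sum>s\<in>UNIV. \<bar>d (Suc j) s - d j s\<bar>)"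
      unfolding sum.distrib sum_distrib_right[symmetric] sum_distrib_left[symmetric] visitation_from_distribution(2)[OF P \<rho>]
      by (subst sum.swap) simp
    also have "(\<Sum>j<n. \<Sum>s\<in>UNIV. \<bar>d (Suc j) s - d j s\<bar>) \<le>
      (\<Sum>j<n. \<gamma> * real CARD('s) * R / ((1 - \<gamma>) * r) * norm (V (Suc j) - V j))"
      by (intro sum_mono visitation_step)
    \<comment> \<open>The second factor \<open>real CARD('s) / (1 - \<gamma>)\<close> is the bound
      on the length of the value sequence, independent of \<open>n\<close>.\<close>
    also have "\<dots> \<le> \<gamma> * real CARD('s) * R / ((1 - \<gamma>) * r) * (real CARD('s) / (1 - \<gamma>))"
      unfolding sum_distrib_left[symmetric]
      using discount r \<open>0 \<le> R\<close> by (intro mult_left_mono sum_norm_V_diff) auto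
    also have "\<dots> = \<gamma> * (real CARD('s))\<^sup>2 * R / ((1 - \<gamma>)\<^sup>2 * r)"
      by (simp add: power2_eq_square mult_ac)
    finally show "(\<Sum>s\<in>UNIV. \<Sum>j<Suc n. d j s * (D j s - D (Suc j) s))
      \<le> D_w + D_w_star * (\<gamma> * (real CARD('s))\<^sup>2 * R / ((1 - \<gamma>)\<^sup>2 * r))"
      using star by (simp add: mult_left_mono)
  qed (use M eta_pos optimal[OF iterate_policy] in \<open>auto simp: less_imp_le\<close>)
  finally show ?thesis .
qed

end

end

section \<open>The bound with the constants of the theorem\<close>

theorem theoremB1:
  fixes c :: "'s::finite \<Rightarrow> 'a::finite \<Rightarrow> real"
    and \<gamma> \<eta> \<mu> R M r_star D_w D_w_star :: real
    and PN :: "real^'s^'a^'s"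
    and U :: "(real^'s^'a^'s) set"
    and Rsa :: "'s \<Rightarrow> 'a \<Rightarrow> real"
    and \<rho> :: "real^'s"
    and \<pi>_star :: "real^'a^'s"
    and w :: "real^'a \<Rightarrow> real"
    and G :: "nat \<Rightarrow> 's \<Rightarrow> real^'a \<Rightarrow> real^'a"
    and \<pi> :: "nat \<Rightarrow> real^'a^'s"
    and k :: nat
  assumes mdp: "robust_mdp c \<gamma> PN U"
    and Rsa_pos: "\<And>s a. Rsa s a > 0"
    and strongly_convex_sets: "\<And>s a. rel_strongly_convex (Rsa s a) (ambiguity_set PN U s a)"
    and R_def: "R = Max (range (\<lambda>(s, a). Rsa s a))"
    and dim: "\<And>s a. aff_dim (ambiguity_set PN U s a) = int CARD('s) - 1"
    and r_star_def: "r_star = r_min c \<gamma> PN U"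
    and r_star_pos: "r_star > 0"
    and rho: "\<rho> \<in> prob_simplex"
    and optimal: "optimal_policy c \<gamma> PN U \<pi>_star"
    and M_finite: "mismatch \<gamma> PN U \<pi>_star \<rho> < \<infinity>"
    and M_def: "M = enn2real (mismatch \<gamma> PN U \<pi>_star \<rho>)"
    and w_convex: "strictly_convex w"
    and subgradients: "\<And>j s p. p \<in> prob_simplex \<Longrightarrow> G j s p \<in> subdifferential w p"
    and eta_pos: "\<eta> > 0"
    and algorithm: "rpmd c \<gamma> PN U w G (\<lambda>j. \<eta>) \<pi>"
    and D_w_def: "D_w = (SUP (\<pi>', s)\<in>policies \<times> UNIV. bregman w (G 0 s) (\<pi>' $ s) (\<pi> 0 $ s))"
    and mu_pos: "\<mu> > 0"
    and w_strongly_convex: "\<And>j s \<pi>' \<pi>''. \<pi>' \<in> policies \<Longrightarrow> \<pi>'' \<in> policies \<Longrightarrow>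
      bregman w (G j s) (\<pi>' $ s) (\<pi>'' $ s) \<ge> \<mu> / 2 * (norm1 (\<pi>' $ s - \<pi>'' $ s))\<^sup>2"
    and D_w_star_finite: "bdd_above
      ((\<lambda>(j, \<pi>', s). bregman w (G j s) (\<pi>_star $ s) (\<pi>' $ s)) ` (UNIV \<times> policies \<times> UNIV))"
    and D_w_star_def: "D_w_star = (SUP (j, \<pi>', s)\<in>UNIV \<times> policies \<times> UNIV.
      bregman w (G j s) (\<pi>_star $ s) (\<pi>' $ s))"
    and k_ge_1: "k \<ge> 1"
  shows "objective c \<gamma> PN U \<rho> (\<pi> k) - objective c \<gamma> PN U \<rho> \<pi>_star
    \<le> M / ((1 - \<gamma>) * real k) * (objective c \<gamma> PN U \<rho> (\<pi> 0) - objective c \<gamma> PN U \<rho> \<pi>_star)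
      + D_w / ((1 - \<gamma>) * \<eta> * real k)
      + 2 * \<gamma> * (real CARD('s))\<^sup>2 * R * D_w_star
          / ((1 - \<gamma>) powr (7 / 2) * r_star * sqrt (\<eta> * \<mu> * real k))"
proof -
  interpret robust_mirror_descent c \<gamma> PN U \<eta> w G \<pi>
    by unfold_locales (use mdp eta_pos subgradients algorithm in \<open>auto simp: robust_mdp_def\<close>)
  let ?f = "objective c \<gamma> PN U \<rho>" and ?S = "real CARD('s)"
  have star: "\<pi>_star \<in> policies"
    using optimal by (simp add: optimal_policy_def)
  have f_star: "?f \<pi>_star \<le> ?f \<pi>'" if "\<pi>' \<in> policies" for \<pi>'
    using optimal rho that unfolding optimal_policy_def objective_def prob_simplex_def
    by (auto intro!: sum_mono mult_left_mono)
  have M: "0 \<le> M"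
    by (simp add: M_def)
  have D_w: "bregman w (G 0 s) (\<pi>' $ s) (\<pi> 0 $ s) \<le> D_w" if "\<pi>' \<in> policies" for \<pi>' s
    unfolding D_w_def using cSUP_upper[OF _ bdd_above_bregman[OF w_convex], of "(\<pi>', s)"] that by auto
  have D_star: "bregman w (G j s) (\<pi>_star $ s) (\<pi> j $ s) \<le> D_w_star" for j s
    unfolding D_w_star_def using cSUP_upper[OF _ D_w_star_finite, of "(j, \<pi> j, s)"] iterate_policy by auto
  have D_nonneg: "0 \<le> D_w" "0 \<le> D_w_star"
    using D_w[OF star, of undefined] D_star[of 0 undefined]
      bregman_iterate_nonneg[of 0 undefined "\<pi>_star $ undefined" 0 undefined] by linarith+
  have Rsa_le: "Rsa s a \<le> R" for s a
    unfolding R_def by (intro Max_ge) (auto intro: image_eqI[of _ _ "(s, a)"])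
  have R: "0 < R"
    using Rsa_le Rsa_pos less_le_trans by blast
  have r_le: "r_star \<le> norm (closest_point zero_sum_space (V j))" for j
    unfolding r_star_def by (rule r_min_le[OF iterate_policy])
  \<comment> \<open>The common factor of the third term and of the error in
    \<open>mirror_descent_bound\<close>; what remains to be compared are powers of
    \<open>1 - \<gamma>\<close> and the dependence on \<open>\<eta>\<close>, \<open>\<mu>\<close>
    and \<open>k\<close>.\<close>
  define X where "X = D_w_star * (\<gamma> * ?S\<^sup>2 * R / r_star)"
  have X: "0 \<le> X"
    unfolding X_def using D_nonneg R discount r_star_pos by simp
  have A: "0 \<le> M / ((1 - \<gamma>) * real k) * (?f (\<pi> 0) - ?f \<pi>_star)"
    using M discount f_star[OF iterate_policy] by simp
  have third: "2 * \<gamma> * ?S\<^sup>2 * R * D_w_star / ((1 - \<gamma>) powr (7 / 2) * r_star * sqrt (\<eta> * \<mu> * real k))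
    = X * (2 / ((1 - \<gamma>) ^ 3 * (sqrt (1 - \<gamma>) * sqrt (\<eta> * \<mu> * real k))))"
  proof -
    have "(1 - \<gamma>) powr (7 / 2) = (1 - \<gamma>) powr (3 + 1 / 2)"
      by simp
    also have "\<dots> = (1 - \<gamma>) ^ 3 * sqrt (1 - \<gamma>)"
      using discount by (simp only: powr_add powr_half_sqrt) (simp add: powr_numeral powr_half_sqrt)
    finally show ?thesis
      by (simp add: X_def mult_ac)
  qed
  have third_nonneg: "0 \<le> X * (2 / ((1 - \<gamma>) ^ 3 * (sqrt (1 - \<gamma>) * sqrt (\<eta> * \<mu> * real k))))"
    using X discount eta_pos mu_pos by simp
  have k: "0 < real k"
    using k_ge_1 by simp
  \<comment> \<open>The threshold \<open>\<mu> / 2\<close> is the lower bound on \<open>D_w\<close>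
    available when there are two different actions; with a single action there is only one
    policy.\<close>
  consider (trivial) "\<forall>a b :: 'a. a = b" | (short) a b :: 'a where "a \<noteq> b" "\<eta> * real k \<le> \<mu> / 2" | (long) "\<mu> / 2 < \<eta> * real k"
    by fastforce
  then show ?thesis
  proof cases
    case trivial
    have "p = q" if "p \<in> prob_simplex" "q \<in> prob_simplex" for p q :: "real^'a"
    proof -
      have "UNIV = {a}" for a :: 'a
        using trivial by auto
      then have "p $ a = 1" if "p \<in> prob_simplex" for p :: "real^'a" and a
        using that unfolding prob_simplex_def by (metis (mono_tags, lifting) mem_Collect_eq sum.empty sum.insert finite.emptyI empty_iff add_0_right)
      then show ?thesis
        using that by (simp add: vec_eq_iff)
    qed
    then have "\<pi> k = \<pi>_star"
      using iterate_in_prob_simplex star by (auto simp: vec_eq_iff[of "\<pi> k"] policies_def)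
    moreover have "0 \<le> D_w / ((1 - \<gamma>) * \<eta> * real k)"
      using D_nonneg discount eta_pos by simp
    ultimately show ?thesis
      unfolding third using A third_nonneg by simp
  next
    case short
    obtain i where i: "1 \<le> norm1 (axis i 1 - \<pi> 0 $ undefined)"
      using vertex_far_from_policy[OF iterate_in_prob_simplex short(1)] by blast
    \<comment> \<open>The deterministic policy at a vertex far from the initial policy in one state;
      strong convexity there gives \<open>\<mu> / 2 \<le> D_w\<close>.\<close>
    define \<pi>' :: "real^'a^'s" where "\<pi>' = (\<chi> s. axis i 1)"
    have \<pi>': "\<pi>' \<in> policies"
      by (auto simp: \<pi>'_def policies_def prob_simplex_def axis_def)
    have "\<mu> / 2 * 1 \<le> \<mu> / 2 * (norm1 (\<pi>' $ undefined - \<pi> 0 $ undefined))\<^sup>2"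
      using mu_pos i by (intro mult_left_mono) (auto simp: \<pi>'_def)
    also have "\<dots> \<le> D_w"
      using w_strongly_convex[OF \<pi>' iterate_policy] D_w[OF \<pi>'] order_trans by blast
    finally have "\<eta> * real k \<le> D_w"
      using short by simp
    then have "\<eta> * real k / ((1 - \<gamma>) * \<eta> * real k) \<le> D_w / ((1 - \<gamma>) * \<eta> * real k)"
      using discount eta_pos by (intro divide_right_mono) auto
    \<comment> \<open>The second term of the claim thus already dominates the largest possible gap
      between two objectives.\<close>
    then have "1 / (1 - \<gamma>) \<le> D_w / ((1 - \<gamma>) * \<eta> * real k)"
      using eta_pos k by simp
    moreover have "?f (\<pi> k) - ?f \<pi>_star \<le> 1 / (1 - \<gamma>)"
    proof -
      have "?f (\<pi> k) - ?f \<pi>_star \<le> (\<Sum>s\<in>UNIV. \<rho> $ s * (1 / (1 - \<gamma>)))"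
        unfolding objective_def sum_subtractf[symmetric] right_diff_distrib[symmetric]
      proof (intro sum_mono mult_left_mono)
        show "V k $ s - robust_V c \<gamma> PN U \<pi>_star $ s \<le> 1 / (1 - \<gamma>)" for s
          using robust_V_bounds(2)[OF iterate_policy, of k s] robust_V_bounds(1)[OF star, of s] by linarith
      qed (use rho in \<open>auto simp: prob_simplex_def\<close>)
      then show ?thesis
        using rho by (simp add: prob_simplex_def sum_divide_distrib[symmetric])
    qed
    ultimately show ?thesis
      unfolding third using A third_nonneg by linarith
  next
    case long
    obtain n where n: "k = Suc n"
      using k_ge_1 by (cases k) auto
    have "(1 - \<gamma>) * real k * (?f (\<pi> k) - ?f \<pi>_star) \<le> M * (?f (\<pi> 0) - ?f \<pi>_star)
      + (D_w + D_w_star * (\<gamma> * ?S\<^sup>2 * R / ((1 - \<gamma>)\<^sup>2 * r_star))) / \<eta>"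
      unfolding n
    proof (rule mirror_descent_bound[OF star rho f_star M _ D_w[OF star] D_star _ dim r_star_pos r_le])
      show "visitation_from \<gamma> (PN + u) \<pi>_star \<rho> s \<le> M * \<rho> $ s" if "u \<in> U" for u s
        unfolding M_def using rho by (intro visitation_le_mismatch[OF M_finite that]) (simp add: prob_simplex_def)
      show "\<exists>R'>0. R' \<le> R \<and> rel_strongly_convex R' (ambiguity_set PN U s a)" for s a
        using Rsa_pos Rsa_le strongly_convex_sets by blast
    qed
    also have "D_w_star * (\<gamma> * ?S\<^sup>2 * R / ((1 - \<gamma>)\<^sup>2 * r_star)) = X / (1 - \<gamma>)\<^sup>2"
      by (simp add: X_def)
    finally have "?f (\<pi> k) - ?f \<pi>_star \<le> (M * (?f (\<pi> 0) - ?f \<pi>_star) + (D_w + X / (1 - \<gamma>)\<^sup>2) / \<eta>) / ((1 - \<gamma>) * real k)"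
      using discount k by (simp add: pos_le_divide_eq mult.commute)
    also have "\<dots> = M / ((1 - \<gamma>) * real k) * (?f (\<pi> 0) - ?f \<pi>_star) + D_w / ((1 - \<gamma>) * \<eta> * real k)
      + X * (1 / ((1 - \<gamma>) ^ 3 * (\<eta> * real k)))"
      by (simp add: add_divide_distrib power3_eq_cube power2_eq_square mult_ac)
    \<comment> \<open>After squaring, this asks for
      \<open>(1 - \<gamma>) * \<mu> \<le> 4 * (\<eta> * real k)\<close>, which the case assumption
      provides.\<close>
    also have "X * (1 / ((1 - \<gamma>) ^ 3 * (\<eta> * real k))) \<le> X * (2 / ((1 - \<gamma>) ^ 3 * (sqrt (1 - \<gamma>) * sqrt (\<eta> * \<mu> * real k))))"
    proof (rule mult_left_mono[OF _ X])
      have "sqrt (1 - \<gamma>) * sqrt (\<eta> * \<mu> * real k) = sqrt ((1 - \<gamma>) * \<mu> * (\<eta> * real k))"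
        by (simp add: real_sqrt_mult[symmetric] mult_ac)
      also have "\<dots> \<le> sqrt ((2 * (\<eta> * real k))\<^sup>2)"
      proof (rule real_sqrt_le_mono)
        have "(1 - \<gamma>) * \<mu> \<le> 1 * \<mu>"
          using discount mu_pos by (intro mult_right_mono) auto
        then have "(1 - \<gamma>) * \<mu> \<le> 4 * (\<eta> * real k)"
          using long mu_pos by linarith
        then have "(1 - \<gamma>) * \<mu> * (\<eta> * real k) \<le> 4 * (\<eta> * real k) * (\<eta> * real k)"
          using eta_pos by (intro mult_right_mono) auto
        then show "(1 - \<gamma>) * \<mu> * (\<eta> * real k) \<le> (2 * (\<eta> * real k))\<^sup>2"
          by (simp add: power2_eq_square mult_ac)
      qed
      also have "\<dots> = 2 * (\<eta> * real k)"
        using eta_pos by (subst real_sqrt_abs) simp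
      finally have le: "sqrt (1 - \<gamma>) * sqrt (\<eta> * \<mu> * real k) \<le> 2 * (\<eta> * real k)" .
      have "1 / ((1 - \<gamma>) ^ 3 * (\<eta> * real k)) = 2 / ((1 - \<gamma>) ^ 3 * (2 * (\<eta> * real k)))"
        by simp
      also have "\<dots> \<le> 2 / ((1 - \<gamma>) ^ 3 * (sqrt (1 - \<gamma>) * sqrt (\<eta> * \<mu> * real k)))"
        using discount eta_pos mu_pos k by (intro divide_left_mono mult_left_mono le mult_pos_pos) auto
      finally show "1 / ((1 - \<gamma>) ^ 3 * (\<eta> * real k)) \<le> 2 / ((1 - \<gamma>) ^ 3 * (sqrt (1 - \<gamma>) * sqrt (\<eta> * \<mu> * real k)))" .
    qed
    finally show ?thesis
      unfolding third by simp
  qed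
qed

end
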